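(* Let $0<q<1$ and $n\ge1$. If $\varphi:\mathrm{Pol}(\Sigma_q^{2n})\to B(\mathcal{H})$ is an irreducible representation on some Hilbert space $\mathcal{H}$, then, up to unitary equivalence, $\varphi=\epsilon$ or $\varphi=\sigma_n$.
   Context: $\mathrm{Pol}(\Sigma_q^{2n})$ is the unital complex $*$-algebra generated by $a_i,a_i^*$ ($1\le i\le n$) and $t=t^*$ with relations $$a_it=q^2ta_i,\qquad a_ia_j=q^{-1}a_ja_i\ (i<j),\qquad a_ia_j^*=q^3a_j^*a_i\ (i<j),$$ $$a_ia_i^*=q^2a_i^*a_i+q^2(1-q^2)\sum_{\ell<i}a_\ell^*a_\ell+(1-q^2)t^2,\qquad \sum_{i=1}^nq^2a_i^*a_i=t-t^2 .$$ Representations are unital $*$-representations by bounded operators. $\epsilon$ is the one-dimensional representation $\epsilon(a_i)=\epsilon(t)=0$, $\epsilon(1)=1$. The representation $\sigma_n$ on $\ell^2(\mathbb{N})^{\otimes n}$ is defined as follows. On $\ell^2(\mathbb{N})$ with orthonormal basis $|m\rangle$, $m=0,1,2,\dots$, let $\sigma(\alpha)|m\rangle=q^{m-1}(1-q^{2m})^{1/2}|m-1\rangle$ and $\sigma(\tau)|m\rangle=q^{2m}|m\rangle$; let $\alpha_i,\tau_i$ denote the operators on $\ell^2(\mathbb{N})^{\otimes n}$ acting as $\sigma(\alpha),\sigma(\tau)$ on the $i$-th factor and as the identity on the others. Let $M$ be the $n\times n$ matrix with $M_{ii}=0$ and $M_{ij}=1$, $M_{ji}=1/2$ for $i<j$.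 Then $\sigma_n(a_i)=\alpha_i\prod_k\tau_k^{M_{ik}}$ and $\sigma_n(t)=\prod_i\tau_i$, with $\tau_k^{1/2}$ the positive square root. *)

theory Defs
  imports "HOL-Analysis.Analysis"
begin

section \<open>Complex Hilbert spaces\<close>

text \<open>
  A complex inner product space is a \<^class>\<open>real_inner\<close> space with a complex scalar multiplication
  and a sesquilinear form, linear in its second argument, whose real part is the real inner
  product. The norm, the metric and the positivity of the form are those of \<^class>\<open>real_inner\<close>.
\<close>

class complex_inner = real_inner +
  fixes scaleC :: "complex \<Rightarrow> 'a \<Rightarrow> 'a" (infixr "*\<^sub>C" 75)
    and cinner :: "'a \<Rightarrow> 'a \<Rightarrow> complex"
  assumes scaleC_add_right: "a *\<^sub>C (x + y) = a *\<^sub>C x + a *\<^sub>C y"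
    and scaleC_add_left: "(a + b) *\<^sub>C x = a *\<^sub>C x + b *\<^sub>C x"
    and scaleC_scaleC: "a *\<^sub>C b *\<^sub>C x = (a * b) *\<^sub>C x"
    and scaleR_scaleC: "r *\<^sub>R x = complex_of_real r *\<^sub>C x"
    and cinner_commute: "cinner x y = cnj (cinner y x)"
    and cinner_add_right: "cinner x (y + z) = cinner x y + cinner x z"
    and cinner_scaleC_right: "cinner x (a *\<^sub>C y) = a * cinner x y"
    and inner_eq_Re_cinner: "x \<bullet> y = Re (cinner x y)"

class chilbert_space = complex_inner + banach

lemma scaleC_one: "1 *\<^sub>C x = (x :: 'a::complex_inner)"
  by (metis of_real_1 scaleR_one scaleR_scaleC)

lemma vector_space_scaleC: "vector_space (scaleC :: complex \<Rightarrow> 'a::complex_inner \<Rightarrow> 'a)"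
  by unfold_locales (simp_all add: scaleC_add_right scaleC_add_left scaleC_scaleC scaleC_one)

lemma scaleC_zero_left: "0 *\<^sub>C x = (0 :: 'a::complex_inner)"
  by (metis of_real_0 scaleR_zero_left scaleR_scaleC)

lemma scaleC_zero_right: "a *\<^sub>C (0 :: 'a::complex_inner) = 0"
  by (metis add_cancel_left_left scaleC_add_right)

lemma scaleC_minus_one: "(-1) *\<^sub>C x = - (x :: 'a::complex_inner)"
  by (metis of_real_1 of_real_minus scaleR_minus1_left scaleR_scaleC)

lemma cinner_add_left: "cinner (x + y) z = cinner x z + cinner y (z :: 'a::complex_inner)"
  by (metis cinner_add_right cinner_commute complex_cnj_add)

lemma cinner_scaleC_left: "cinner (a *\<^sub>C x) y = cnj a * cinner x (y :: 'a::complex_inner)"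
  by (metis cinner_commute cinner_scaleC_right complex_cnj_mult)

lemma cinner_zero_left [simp]: "cinner 0 (y :: 'a::complex_inner) = 0"
  by (metis add_cancel_left_left cinner_add_left)

lemma cinner_zero_right [simp]: "cinner (y :: 'a::complex_inner) 0 = 0"
  by (metis add_cancel_left_left cinner_add_right)

lemma cinner_diff_right: "cinner x (y - z) = cinner x y - cinner x (z :: 'a::complex_inner)"
  by (metis add_diff_cancel cinner_add_right diff_add_cancel)

lemma cinner_ext:
  assumes "\<And>x. cinner x y = cinner x (z :: 'a::complex_inner)"
  shows "y = z"
proof -
  have "(y - z) \<bullet> (y - z) = 0"
    by (simp add: inner_eq_Re_cinner cinner_diff_right assms)
  then show ?thesis by simp
qed

lemma norm_scaleC: "norm (a *\<^sub>C x) = cmod a * norm (x :: 'a::complex_inner)"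
proof -
  have "cinner x x = complex_of_real (x \<bullet> x)"
    by (metis Im_complex_of_real Re_complex_of_real cinner_commute cnj.simps(2) complex_eqI
        inner_eq_Re_cinner neg_equal_zero)
  then have "(a *\<^sub>C x) \<bullet> (a *\<^sub>C x) = Re (cnj a * a * complex_of_real (x \<bullet> x))"
    by (simp add: inner_eq_Re_cinner cinner_scaleC_left cinner_scaleC_right mult_ac)
  also have "\<dots> = (cmod a)\<^sup>2 * (norm x)\<^sup>2"
    unfolding cmod_power2 power2_norm_eq_inner[of x]
    by (simp add: power2_eq_square algebra_simps)
  finally show ?thesis
    by (metis norm_ge_zero power2_eq_imp_eq power2_norm_eq_inner power_mult_distrib
        mult_nonneg_nonneg)
qed

instantiation complex :: chilbert_space
begin

definition scaleC_complex_def: "a *\<^sub>C (x :: complex) = a * x"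
definition cinner_complex_def: "cinner x (y :: complex) = cnj x * y"

instance
  by standard
    (auto simp: scaleC_complex_def cinner_complex_def algebra_simps scaleR_conv_of_real
      inner_complex_def)

end

section \<open>Square-summable families\<close>

typedef 'i ell2 = "{f :: 'i \<Rightarrow> complex. (\<lambda>i. (cmod (f i))\<^sup>2) summable_on UNIV}"
  by (rule exI[of _ "\<lambda>_. 0"]) simp

lemma Rep_ell2_summable: "(\<lambda>i. (cmod (Rep_ell2 f i))\<^sup>2) summable_on UNIV"
  using Rep_ell2 by auto

lemma ell2_eqI: "(\<And>i. Rep_ell2 f i = Rep_ell2 g i) \<Longrightarrow> f = g"
  by (metis Rep_ell2_inject ext)

lemma Rep_Abs_ell2: "(\<lambda>i. (cmod (f i))\<^sup>2) summable_on UNIV \<Longrightarrow> Rep_ell2 (Abs_ell2 f) = f"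
  by (simp add: Abs_ell2_inverse)

lemma square_summable_add:
  fixes f g :: "'i \<Rightarrow> complex"
  assumes "(\<lambda>i. (cmod (f i))\<^sup>2) summable_on UNIV" "(\<lambda>i. (cmod (g i))\<^sup>2) summable_on UNIV"
  shows "(\<lambda>i. (cmod (f i + g i))\<^sup>2) summable_on UNIV"
proof -
  have "(\<lambda>i. 2 * ((cmod (f i))\<^sup>2 + (cmod (g i))\<^sup>2)) summable_on UNIV"
    by (intro summable_on_cmult_right summable_on_add assms)
  moreover have "(cmod (f i + g i))\<^sup>2 \<le> 2 * ((cmod (f i))\<^sup>2 + (cmod (g i))\<^sup>2)" for i
  proof -
    have "(cmod (f i + g i))\<^sup>2 \<le> (cmod (f i) + cmod (g i))\<^sup>2"
      by (intro power_mono norm_triangle_ineq) auto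
    also have "\<dots> \<le> 2 * ((cmod (f i))\<^sup>2 + (cmod (g i))\<^sup>2)"
      using sum_squares_bound[of "cmod (f i)" "cmod (g i)"]
      by (simp add: power2_sum)
    finally show ?thesis .
  qed
  ultimately show ?thesis
    by (rule summable_on_comparison_test) auto
qed

lemma square_summable_scale:
  fixes f :: "'i \<Rightarrow> complex"
  assumes "(\<lambda>i. (cmod (f i))\<^sup>2) summable_on UNIV"
  shows "(\<lambda>i. (cmod (c * f i))\<^sup>2) summable_on UNIV"
  using summable_on_cmult_right[OF assms, of "(cmod c)\<^sup>2"]
  by (simp add: norm_mult power_mult_distrib)

lemma summable_cnj_mult:
  fixes f g :: "'i \<Rightarrow> complex"
  assumes "(\<lambda>i. (cmod (f i))\<^sup>2) summable_on UNIV" "(\<lambda>i. (cmod (g i))\<^sup>2) summable_on UNIV"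
  shows "(\<lambda>i. cnj (f i) * g i) summable_on UNIV"
  by (rule abs_summable_summable, rule abs_summable_product)
    (use assms in \<open>simp_all add: norm_mult power2_eq_square\<close>)

instantiation ell2 :: (type) complex_inner
begin

definition zero_ell2_def: "0 = Abs_ell2 (\<lambda>_. 0)"
definition plus_ell2_def: "f + g = Abs_ell2 (\<lambda>i. Rep_ell2 f i + Rep_ell2 g i)"
definition minus_ell2_def: "f - g = Abs_ell2 (\<lambda>i. Rep_ell2 f i - Rep_ell2 g i)"
definition uminus_ell2_def: "- f = Abs_ell2 (\<lambda>i. - Rep_ell2 f i)"
definition scaleC_ell2_def: "a *\<^sub>C f = Abs_ell2 (\<lambda>i. a * Rep_ell2 f i)"
definition cinner_ell2_def:
  "cinner f g = (\<Sum>\<^sub>\<infinity>i. cnj (Rep_ell2 f i) * Rep_ell2 g i)"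
definition scaleR_ell2_def: "r *\<^sub>R f = complex_of_real r *\<^sub>C (f :: 'a ell2)"
definition inner_ell2_def: "f \<bullet> g = Re (cinner f (g :: 'a ell2))"
definition norm_ell2_def: "norm f = sqrt (f \<bullet> (f :: 'a ell2))"
definition sgn_ell2_def: "sgn f = inverse (norm f) *\<^sub>R (f :: 'a ell2)"
definition dist_ell2_def: "dist f g = norm (f - (g :: 'a ell2))"
definition uniformity_ell2_def:
  "uniformity = (INF e\<in>{0<..}. principal {(f, g :: 'a ell2). dist f g < e})"
definition open_ell2_def:
  "open U = (\<forall>f\<in>U. \<forall>\<^sub>F (f', g) in uniformity. f' = f \<longrightarrow> (g :: 'a ell2) \<in> U)"

lemma Rep_zero_ell2: "Rep_ell2 0 i = 0"
  by (simp add: zero_ell2_def Rep_Abs_ell2)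

lemma Rep_plus_ell2: "Rep_ell2 (f + g) i = Rep_ell2 f i + Rep_ell2 g i"
  by (simp add: plus_ell2_def Rep_Abs_ell2 square_summable_add Rep_ell2_summable)

lemma Rep_uminus_ell2: "Rep_ell2 (- f) i = - Rep_ell2 f i"
  by (simp add: uminus_ell2_def Rep_Abs_ell2 Rep_ell2_summable)

lemma Rep_minus_ell2: "Rep_ell2 (f - g) i = Rep_ell2 f i - Rep_ell2 g i"
  using square_summable_add[OF Rep_ell2_summable[of f] Rep_ell2_summable[of "- g"]]
  by (simp add: minus_ell2_def Rep_Abs_ell2 Rep_uminus_ell2)

lemma Rep_scaleC_ell2: "Rep_ell2 (a *\<^sub>C f) i = a * Rep_ell2 f i"
  by (simp add: scaleC_ell2_def Rep_Abs_ell2 square_summable_scale Rep_ell2_summable)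

lemma Rep_scaleR_ell2: "Rep_ell2 (r *\<^sub>R f) i = complex_of_real r * Rep_ell2 f i"
  by (simp add: scaleR_ell2_def Rep_scaleC_ell2)

lemmas Rep_ell2_simps =
  Rep_zero_ell2 Rep_plus_ell2 Rep_uminus_ell2 Rep_minus_ell2 Rep_scaleC_ell2 Rep_scaleR_ell2

lemma cinner_ell2_commute: "cinner f g = cnj (cinner g (f :: 'a ell2))"
  unfolding cinner_ell2_def by (subst infsum_cnj[symmetric]) (simp add: mult_ac)

lemma cinner_ell2_add: "cinner f (g + h) = cinner f g + cinner f (h :: 'a ell2)"
  unfolding cinner_ell2_def Rep_plus_ell2 distrib_left
  by (intro infsum_add summable_cnj_mult Rep_ell2_summable)

lemma cinner_ell2_scaleC: "cinner f (a *\<^sub>C g) = a * cinner f (g :: 'a ell2)"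
  unfolding cinner_ell2_def
  by (subst infsum_cmult_right'[symmetric]) (simp add: Rep_scaleC_ell2 mult_ac)

lemma cinner_ell2_self:
  "cinner f (f :: 'a ell2) = complex_of_real (\<Sum>\<^sub>\<infinity>i. (cmod (Rep_ell2 f i))\<^sup>2)"
  using infsumI[OF has_sum_of_real[OF has_sum_infsum[OF Rep_ell2_summable[of f]],
      where 'a = complex]]
  by (simp only: cinner_ell2_def complex_norm_square mult.commute)

lemma inner_ell2_self: "f \<bullet> f = (\<Sum>\<^sub>\<infinity>i. (cmod (Rep_ell2 (f :: 'a ell2) i))\<^sup>2)"
  by (simp add: inner_ell2_def cinner_ell2_self)

instance
proof
  fix f g h :: "'a ell2" and a b :: complex and r s :: real
  show "f + g + h = f + (g + h)" "f + g = g + f" "0 + f = f" "- f + f = 0" "f - g = f + - g"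
    "r *\<^sub>R (f + g) = r *\<^sub>R f + r *\<^sub>R g" "(r + s) *\<^sub>R f = r *\<^sub>R f + s *\<^sub>R f"
    "r *\<^sub>R s *\<^sub>R f = (r * s) *\<^sub>R f" "1 *\<^sub>R f = f"
    "a *\<^sub>C (f + g) = a *\<^sub>C f + a *\<^sub>C g" "(a + b) *\<^sub>C f = a *\<^sub>C f + b *\<^sub>C f"
    "a *\<^sub>C b *\<^sub>C f = (a * b) *\<^sub>C f" "r *\<^sub>R f = complex_of_real r *\<^sub>C f"
    by (rule ell2_eqI, simp add: Rep_ell2_simps algebra_simps)+
  show "sgn f = inverse (norm f) *\<^sub>R f" by (rule sgn_ell2_def)
  show "dist f g = norm (f - g)" by (rule dist_ell2_def)
  show "uniformity = (INF e\<in>{0<..}. principal {(f, g :: 'a ell2). dist f g < e})"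
    by (rule uniformity_ell2_def)
  show "open U = (\<forall>f\<in>U. \<forall>\<^sub>F (f', g) in uniformity. f' = f \<longrightarrow> g \<in> U)" for U :: "'a ell2 set"
    by (rule open_ell2_def)
  show "norm f = sqrt (f \<bullet> f)" by (rule norm_ell2_def)
  show "cinner f g = cnj (cinner g f)" by (rule cinner_ell2_commute)
  show "cinner f (g + h) = cinner f g + cinner f h" by (rule cinner_ell2_add)
  show "cinner f (a *\<^sub>C g) = a * cinner f g" by (rule cinner_ell2_scaleC)
  show "f \<bullet> g = Re (cinner f g)" by (rule inner_ell2_def)
  show "f \<bullet> g = g \<bullet> f"
    unfolding inner_ell2_def by (subst cinner_ell2_commute) simp
  show "(f + g) \<bullet> h = f \<bullet> h + g \<bullet> h"
    unfolding inner_ell2_def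
    by (subst (1 2 3) cinner_ell2_commute) (simp add: cinner_ell2_add)
  show "(r *\<^sub>R f) \<bullet> g = r * (f \<bullet> g)"
    unfolding inner_ell2_def scaleR_ell2_def
    by (subst (1 2) cinner_ell2_commute) (simp add: cinner_ell2_scaleC)
  show "0 \<le> f \<bullet> f"
    by (simp add: inner_ell2_self infsum_nonneg)
  show "(f \<bullet> f = 0) = (f = 0)"
  proof
    assume "f \<bullet> f = 0"
    then have "(cmod (Rep_ell2 f i))\<^sup>2 = 0" for i
      using nonneg_infsum_le_0D[OF _ Rep_ell2_summable[of f], of i]
      by (simp add: inner_ell2_self)
    then show "f = 0" by (intro ell2_eqI) (simp add: Rep_zero_ell2)
  next
    assume "f = 0"
    then show "f \<bullet> f = 0" by (simp add: inner_ell2_self Rep_zero_ell2)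
  qed
qed

end

lemma norm_ell2_eq: "(norm f)\<^sup>2 = (\<Sum>\<^sub>\<infinity>i. (cmod (Rep_ell2 (f :: 'i ell2) i))\<^sup>2)"
  by (simp add: power2_norm_eq_inner inner_ell2_self)

lemma sum_le_norm_ell2:
  "finite F \<Longrightarrow> (\<Sum>i\<in>F. (cmod (Rep_ell2 (f :: 'i ell2) i))\<^sup>2) \<le> (norm f)\<^sup>2"
  unfolding norm_ell2_eq by (rule finite_sum_le_infsum[OF Rep_ell2_summable]) auto

lemma coord_le_norm_ell2: "cmod (Rep_ell2 f i) \<le> norm (f :: 'i ell2)"
  by (rule power2_le_imp_le) (use sum_le_norm_ell2[of "{i}" f] in auto)

lemma ell2_bounded_sums:
  fixes f :: "'i \<Rightarrow> complex"
  assumes "\<And>F. finite F \<Longrightarrow> (\<Sum>i\<in>F. (cmod (f i))\<^sup>2) \<le> b"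
  shows "(\<lambda>i. (cmod (f i))\<^sup>2) summable_on UNIV" "(norm (Abs_ell2 f))\<^sup>2 \<le> b"
proof -
  show 1: "(\<lambda>i. (cmod (f i))\<^sup>2) summable_on UNIV"
    by (rule nonneg_bdd_above_summable_on) (auto intro!: bdd_aboveI2[where M = b] assms)
  show "(norm (Abs_ell2 f))\<^sup>2 \<le> b"
    unfolding norm_ell2_eq Rep_Abs_ell2[OF 1] by (rule infsum_le_finite_sums[OF 1]) (auto intro: assms)
qed

instance ell2 :: (type) chilbert_space
proof
  fix X :: "nat \<Rightarrow> 'a ell2"
  assume X: "Cauchy X"
  have C: "Cauchy (\<lambda>n. Rep_ell2 (X n) i)" for i
  proof (rule metric_CauchyI)
    fix e :: real assume "e > 0"
    then obtain N where N: "\<And>m n. m \<ge> N \<Longrightarrow> n \<ge> N \<Longrightarrow> dist (X m) (X n) < e"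
      using metric_CauchyD[OF X] by blast
    have "dist (Rep_ell2 (X m) i) (Rep_ell2 (X n) i) < e" if "m \<ge> N" "n \<ge> N" for m n
      using N[OF that] coord_le_norm_ell2[of "X m - X n" i]
      by (simp add: dist_norm Rep_minus_ell2)
    then show "\<exists>M. \<forall>m\<ge>M. \<forall>n\<ge>M. dist (Rep_ell2 (X m) i) (Rep_ell2 (X n) i) < e" by blast
  qed
  define g where "g i = lim (\<lambda>n. Rep_ell2 (X n) i)" for i
  have g: "(\<lambda>n. Rep_ell2 (X n) i) \<longlonglongrightarrow> g i" for i
    using C[of i] unfolding g_def by (simp add: Cauchy_convergent_iff convergent_LIMSEQ_iff)
  have tail: "\<exists>N. \<forall>n\<ge>N. \<forall>F. finite F \<longrightarrow>
      (\<Sum>i\<in>F. (cmod (g i - Rep_ell2 (X n) i))\<^sup>2) \<le> e\<^sup>2" if "e > 0" for e :: real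
  proof -
    obtain N where N: "\<And>m n. m \<ge> N \<Longrightarrow> n \<ge> N \<Longrightarrow> dist (X m) (X n) < e"
      using metric_CauchyD[OF X \<open>e > 0\<close>] by blast
    have "(\<Sum>i\<in>F. (cmod (g i - Rep_ell2 (X n) i))\<^sup>2) \<le> e\<^sup>2" if "n \<ge> N" "finite F" for n F
    proof (rule tendsto_upperbound)
      show "(\<lambda>m. \<Sum>i\<in>F. (cmod (Rep_ell2 (X m) i - Rep_ell2 (X n) i))\<^sup>2)
          \<longlonglongrightarrow> (\<Sum>i\<in>F. (cmod (g i - Rep_ell2 (X n) i))\<^sup>2)"
        by (intro tendsto_intros g)
      show "\<forall>\<^sub>F m in sequentially. (\<Sum>i\<in>F. (cmod (Rep_ell2 (X m) i - Rep_ell2 (X n) i))\<^sup>2) \<le> e\<^sup>2"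
      proof (rule eventually_sequentiallyI[of N])
        fix m assume "m \<ge> N"
        have "(\<Sum>i\<in>F. (cmod (Rep_ell2 (X m) i - Rep_ell2 (X n) i))\<^sup>2) \<le> (norm (X m - X n))\<^sup>2"
          using sum_le_norm_ell2[OF \<open>finite F\<close>, of "X m - X n"] by (simp add: Rep_minus_ell2)
        also have "\<dots> \<le> e\<^sup>2"
          using N[OF \<open>m \<ge> N\<close> \<open>n \<ge> N\<close>] by (intro power_mono) (auto simp: dist_norm)
        finally show "(\<Sum>i\<in>F. (cmod (Rep_ell2 (X m) i - Rep_ell2 (X n) i))\<^sup>2) \<le> e\<^sup>2" .
      qed
    qed simp
    then show ?thesis by blast
  qed
  obtain N where N: "\<And>F. finite F \<Longrightarrow> (\<Sum>i\<in>F. (cmod (g i - Rep_ell2 (X N) i))\<^sup>2) \<le> 1"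
    using tail[of 1] by auto
  have "(\<lambda>i. (cmod ((g i - Rep_ell2 (X N) i) + Rep_ell2 (X N) i))\<^sup>2) summable_on UNIV"
    by (intro square_summable_add ell2_bounded_sums(1)[OF N] Rep_ell2_summable)
  then have G: "Rep_ell2 (Abs_ell2 g) = g"
    by (simp add: Rep_Abs_ell2)
  have "X \<longlonglongrightarrow> Abs_ell2 g"
  proof (rule metric_LIMSEQ_I)
    fix e :: real assume "e > 0"
    obtain N where N: "\<And>n F. n \<ge> N \<Longrightarrow> finite F \<Longrightarrow>
        (\<Sum>i\<in>F. (cmod (g i - Rep_ell2 (X n) i))\<^sup>2) \<le> (e / 2)\<^sup>2"
      using tail[of "e / 2"] \<open>e > 0\<close> by auto
    have "dist (X n) (Abs_ell2 g) < e" if "n \<ge> N" for n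
    proof -
      have "Abs_ell2 (\<lambda>i. g i - Rep_ell2 (X n) i) = Abs_ell2 g - X n"
        by (simp add: minus_ell2_def G)
      then have "(norm (Abs_ell2 g - X n))\<^sup>2 \<le> (e / 2)\<^sup>2"
        using ell2_bounded_sums(2)[OF N[OF that]] by simp
      then have "norm (Abs_ell2 g - X n) \<le> e / 2"
        by (rule power2_le_imp_le) (use \<open>e > 0\<close> in simp)
      then show ?thesis
        using \<open>e > 0\<close> by (simp add: dist_norm norm_minus_commute)
    qed
    then show "\<exists>N. \<forall>n\<ge>N. dist (X n) (Abs_ell2 g) < e" by blast
  qed
  then show "convergent X" by (auto simp: convergent_def)
qed

section \<open>Unital complex *-algebras and their representations\<close>

definition bounded_clinear :: "('a::complex_inner \<Rightarrow> 'b::complex_inner) \<Rightarrow> bool" where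
  "bounded_clinear F \<longleftrightarrow> bounded_linear F \<and> (\<forall>c x. F (c *\<^sub>C x) = c *\<^sub>C F x)"

definition is_adjoint :: "('a::complex_inner \<Rightarrow> 'b::complex_inner) \<Rightarrow> ('b \<Rightarrow> 'a) \<Rightarrow> bool" where
  "is_adjoint F G \<longleftrightarrow> (\<forall>x y. cinner (F x) y = cinner x (G y))"

definition cadjoint :: "('a::complex_inner \<Rightarrow> 'b::complex_inner) \<Rightarrow> 'b \<Rightarrow> 'a" where
  "cadjoint F = (THE G. is_adjoint F G)"

record 'x star_algebra =
  alg_carrier :: "'x set"
  alg_zero :: 'x
  alg_one :: 'x
  alg_add :: "'x \<Rightarrow> 'x \<Rightarrow> 'x"
  alg_mult :: "'x \<Rightarrow> 'x \<Rightarrow> 'x"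
  alg_scale :: "complex \<Rightarrow> 'x \<Rightarrow> 'x"
  alg_star :: "'x \<Rightarrow> 'x"

definition star_representation :: "'x star_algebra \<Rightarrow> ('x \<Rightarrow> 'h::chilbert_space \<Rightarrow> 'h) \<Rightarrow> bool" where
  "star_representation A \<phi> \<longleftrightarrow>
     (\<forall>x\<in>alg_carrier A. bounded_clinear (\<phi> x)) \<and>
     \<phi> (alg_one A) = id \<and>
     (\<forall>x\<in>alg_carrier A. \<forall>y\<in>alg_carrier A. \<phi> (alg_add A x y) = (\<lambda>v. \<phi> x v + \<phi> y v)) \<and>
     (\<forall>x\<in>alg_carrier A. \<forall>y\<in>alg_carrier A. \<phi> (alg_mult A x y) = \<phi> x \<circ> \<phi> y) \<and>
     (\<forall>c. \<forall>x\<in>alg_carrier A. \<phi> (alg_scale A c x) = (\<lambda>v. c *\<^sub>C \<phi> x v)) \<and>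
     (\<forall>x\<in>alg_carrier A. is_adjoint (\<phi> x) (\<phi> (alg_star A x)))"

text \<open>The zero space does not carry an irreducible representation.\<close>

definition irreducible_representation ::
    "'x star_algebra \<Rightarrow> ('x \<Rightarrow> 'h::chilbert_space \<Rightarrow> 'h) \<Rightarrow> bool" where
  "irreducible_representation A \<phi> \<longleftrightarrow>
     star_representation A \<phi> \<and> (\<exists>v::'h. v \<noteq> 0) \<and>
     (\<forall>S. closed S \<and> module.subspace scaleC S \<and> (\<forall>x\<in>alg_carrier A. \<phi> x ` S \<subseteq> S) \<longrightarrow>
        S = {0} \<or> S = UNIV)"

definition unitary_map :: "('h::chilbert_space \<Rightarrow> 'k::chilbert_space) \<Rightarrow> bool" where
  "unitary_map U \<longleftrightarrow>
     bounded_clinear U \<and> surj U \<and> (\<forall>x y. cinner (U x) (U y) = cinner x y)"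

definition unitarily_equivalent ::
    "'x star_algebra \<Rightarrow> ('x \<Rightarrow> 'h::chilbert_space \<Rightarrow> 'h) \<Rightarrow> ('x \<Rightarrow> 'k::chilbert_space \<Rightarrow> 'k) \<Rightarrow> bool" where
  "unitarily_equivalent A \<phi> \<psi> \<longleftrightarrow>
     (\<exists>U. unitary_map U \<and> (\<forall>x\<in>alg_carrier A. U \<circ> \<phi> x = \<psi> x \<circ> U))"

section \<open>The *-algebra of polynomials on the quantum sphere\<close>

text \<open>
  The index set \<open>{1, \<dots>, n}\<close> of the generators is an arbitrary nonempty finite linear order,
  given by a type \<^typ>\<open>'n\<close> of class \<^class>\<open>finite\<close> and \<^class>\<open>linorder\<close>. The *-algebra with
  generators \<open>a\<^sub>i\<close>, \<open>t\<close> and the relations \<open>rel_t_star\<close>, \<dots>, \<open>rel_sphere\<close> below is the set of all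
  formal *-algebra expressions in the generators modulo the least congruence containing the axioms
  of unital complex *-algebras and these relations.
\<close>

datatype 'n star_term =
    TA 'n
  | TT
  | TZero
  | TOne
  | TAdd "'n star_term" "'n star_term"
  | TMult "'n star_term" "'n star_term"
  | TScale complex "'n star_term"
  | TStar "'n star_term"

definition term_sum :: "('n::{finite,linorder} \<Rightarrow> 'n star_term) \<Rightarrow> 'n set \<Rightarrow> 'n star_term" where
  "term_sum s I = foldr (\<lambda>i. TAdd (s i)) (sorted_list_of_set I) TZero"

inductive pol_eq :: "real \<Rightarrow> 'n::{finite,linorder} star_term \<Rightarrow> 'n star_term \<Rightarrow> bool"
  for q :: real where
  refl: "pol_eq q x x"
| sym: "pol_eq q x y \<Longrightarrow> pol_eq q y x"
| trans: "pol_eq q x y \<Longrightarrow> pol_eq q y z \<Longrightarrow> pol_eq q x z"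
| cong_add: "pol_eq q x x' \<Longrightarrow> pol_eq q y y' \<Longrightarrow> pol_eq q (TAdd x y) (TAdd x' y')"
| cong_mult: "pol_eq q x x' \<Longrightarrow> pol_eq q y y' \<Longrightarrow> pol_eq q (TMult x y) (TMult x' y')"
| cong_scale: "pol_eq q x x' \<Longrightarrow> pol_eq q (TScale c x) (TScale c x')"
| cong_star: "pol_eq q x x' \<Longrightarrow> pol_eq q (TStar x) (TStar x')"
| add_assoc: "pol_eq q (TAdd (TAdd x y) z) (TAdd x (TAdd y z))"
| add_commute: "pol_eq q (TAdd x y) (TAdd y x)"
| add_zero: "pol_eq q (TAdd TZero x) x"
| add_minus: "pol_eq q (TAdd x (TScale (-1) x)) TZero"
| scale_add_right: "pol_eq q (TScale c (TAdd x y)) (TAdd (TScale c x) (TScale c y))"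
| scale_add_left: "pol_eq q (TScale (c + d) x) (TAdd (TScale c x) (TScale d x))"
| scale_scale: "pol_eq q (TScale c (TScale d x)) (TScale (c * d) x)"
| scale_one: "pol_eq q (TScale 1 x) x"
| mult_assoc: "pol_eq q (TMult (TMult x y) z) (TMult x (TMult y z))"
| mult_one_left: "pol_eq q (TMult TOne x) x"
| mult_one_right: "pol_eq q (TMult x TOne) x"
| mult_add_left: "pol_eq q (TMult (TAdd x y) z) (TAdd (TMult x z) (TMult y z))"
| mult_add_right: "pol_eq q (TMult x (TAdd y z)) (TAdd (TMult x y) (TMult x z))"
| mult_scale_left: "pol_eq q (TMult (TScale c x) y) (TScale c (TMult x y))"
| mult_scale_right: "pol_eq q (TMult x (TScale c y)) (TScale c (TMult x y))"
| star_star: "pol_eq q (TStar (TStar x)) x"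
| star_add: "pol_eq q (TStar (TAdd x y)) (TAdd (TStar x) (TStar y))"
| star_scale: "pol_eq q (TStar (TScale c x)) (TScale (cnj c) (TStar x))"
| star_mult: "pol_eq q (TStar (TMult x y)) (TMult (TStar y) (TStar x))"
| rel_t_star: "pol_eq q (TStar TT) TT"
| rel_a_t: "pol_eq q (TMult (TA i) TT) (TScale (of_real (q\<^sup>2)) (TMult TT (TA i)))"
| rel_a_a: "i < j \<Longrightarrow>
    pol_eq q (TMult (TA i) (TA j)) (TScale (of_real (inverse q)) (TMult (TA j) (TA i)))"
| rel_a_astar: "i < j \<Longrightarrow>
    pol_eq q (TMult (TA i) (TStar (TA j))) (TScale (of_real (q ^ 3)) (TMult (TStar (TA j)) (TA i)))"
| rel_astar: "pol_eq q (TMult (TA i) (TStar (TA i)))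
    (TAdd (TAdd (TScale (of_real (q\<^sup>2)) (TMult (TStar (TA i)) (TA i)))
      (TScale (of_real (q\<^sup>2 * (1 - q\<^sup>2))) (term_sum (\<lambda>l. TMult (TStar (TA l)) (TA l)) {l. l < i})))
      (TScale (of_real (1 - q\<^sup>2)) (TMult TT TT)))"
| rel_sphere: "pol_eq q (term_sum (\<lambda>i. TScale (of_real (q\<^sup>2)) (TMult (TStar (TA i)) (TA i))) UNIV)
    (TAdd TT (TScale (-1) (TMult TT TT)))"

definition pol_class :: "real \<Rightarrow> 'n::{finite,linorder} star_term \<Rightarrow> 'n star_term set" where
  "pol_class q x = {y. pol_eq q x y}"

definition Pol :: "real \<Rightarrow> 'n::{finite,linorder} star_term set star_algebra" where
  "Pol q = \<lparr>
     alg_carrier = range (pol_class q),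
     alg_zero = pol_class q TZero,
     alg_one = pol_class q TOne,
     alg_add = (\<lambda>X Y. \<Union>x\<in>X. \<Union>y\<in>Y. pol_class q (TAdd x y)),
     alg_mult = (\<lambda>X Y. \<Union>x\<in>X. \<Union>y\<in>Y. pol_class q (TMult x y)),
     alg_scale = (\<lambda>c X. \<Union>x\<in>X. pol_class q (TScale c x)),
     alg_star = (\<lambda>X. \<Union>x\<in>X. pol_class q (TStar x)) \<rparr>"

lemma pol_class_eq_iff: "pol_class q x = pol_class q y \<longleftrightarrow> pol_eq q x y"
proof
  assume "pol_class q x = pol_class q y"
  then have "y \<in> pol_class q x" by (simp add: pol_class_def pol_eq.refl)
  then show "pol_eq q x y" by (simp add: pol_class_def)
next
  assume "pol_eq q x y"
  then show "pol_class q x = pol_class q y"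
    unfolding pol_class_def by (blast intro: pol_eq.sym pol_eq.trans)
qed

lemma Pol_simps:
  fixes x y :: "'n::{finite,linorder} star_term"
  shows
  "alg_carrier (Pol q :: 'n star_term set star_algebra) = range (pol_class q)"
  "alg_zero (Pol q :: 'n star_term set star_algebra) = pol_class q TZero"
  "alg_one (Pol q :: 'n star_term set star_algebra) = pol_class q TOne"
  "alg_add (Pol q) (pol_class q x) (pol_class q y) = pol_class q (TAdd x y)"
  "alg_mult (Pol q) (pol_class q x) (pol_class q y) = pol_class q (TMult x y)"
  "alg_scale (Pol q) c (pol_class q x) = pol_class q (TScale c x)"
  "alg_star (Pol q) (pol_class q x) = pol_class q (TStar x)"
proof -
  have self: "x \<in> pol_class q x" for x :: "'n star_term"
    by (simp add: pol_class_def pol_eq.refl)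
  have mem: "y \<in> pol_class q x \<Longrightarrow> pol_eq q y x" for x y :: "'n star_term"
    by (simp add: pol_class_def pol_eq.sym)
  have union: "(\<Union>y\<in>Y. f y) = f x" if "x \<in> Y" "\<And>y. y \<in> Y \<Longrightarrow> f y = f x"
    for f :: "'n star_term \<Rightarrow> 'n star_term set" and x Y
    using that by blast
  show "alg_scale (Pol q) c (pol_class q x) = pol_class q (TScale c x)"
    by (simp add: Pol_def, rule union)
      (auto simp: self pol_class_eq_iff dest!: mem intro: pol_eq.cong_scale)
  show "alg_star (Pol q) (pol_class q x) = pol_class q (TStar x)"
    by (simp add: Pol_def, rule union)
      (auto simp: self pol_class_eq_iff dest!: mem intro: pol_eq.cong_star)
  have binary: "(\<Union>x\<in>pol_class q a. \<Union>y\<in>pol_class q b. pol_class q (f x y)) = pol_class q (f a b)"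
    if cong: "\<And>x x' y y'. pol_eq q x x' \<Longrightarrow> pol_eq q y y' \<Longrightarrow> pol_eq q (f x y) (f x' y')"
    for f :: "'n star_term \<Rightarrow> 'n star_term \<Rightarrow> 'n star_term" and a b
  proof -
    have "pol_class q (f x y) = pol_class q (f a b)" if "x \<in> pol_class q a" "y \<in> pol_class q b" for x y
      using that cong by (simp add: pol_class_eq_iff mem)
    then show ?thesis using self[of a] self[of b] by blast
  qed
  show "alg_add (Pol q) (pol_class q x) (pol_class q y) = pol_class q (TAdd x y)"
    by (simp add: Pol_def, rule binary) (rule pol_eq.cong_add)
  show "alg_mult (Pol q) (pol_class q x) (pol_class q y) = pol_class q (TMult x y)"
    by (simp add: Pol_def, rule binary) (rule pol_eq.cong_mult)
qed (simp_all add: Pol_def)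

subsection \<open>Representations determined by the images of the generators\<close>

primrec eval_term ::
    "('n \<Rightarrow> 'h::complex_inner \<Rightarrow> 'h) \<Rightarrow> ('h \<Rightarrow> 'h) \<Rightarrow> 'n star_term \<Rightarrow> 'h \<Rightarrow> 'h" where
  "eval_term a t (TA i) = a i"
| "eval_term a t TT = t"
| "eval_term a t TZero = (\<lambda>v. 0)"
| "eval_term a t TOne = id"
| "eval_term a t (TAdd x y) = (\<lambda>v. eval_term a t x v + eval_term a t y v)"
| "eval_term a t (TMult x y) = eval_term a t x \<circ> eval_term a t y"
| "eval_term a t (TScale c x) = (\<lambda>v. c *\<^sub>C eval_term a t x v)"
| "eval_term a t (TStar x) = cadjoint (eval_term a t x)"

text \<open>
  The choice of the representative \<open>x\<close> does not matter if \<open>a\<close> and \<open>t\<close> satisfy the defining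
  relations, see \<open>star_representation_gen_rep\<close>.
\<close>

definition gen_rep ::
    "('n \<Rightarrow> 'h::complex_inner \<Rightarrow> 'h) \<Rightarrow> ('h \<Rightarrow> 'h) \<Rightarrow> 'n star_term set \<Rightarrow> 'h \<Rightarrow> 'h" where
  "gen_rep a t X = eval_term a t (SOME x. x \<in> X)"

definition eps_rep :: "'n star_term set \<Rightarrow> complex \<Rightarrow> complex" where
  "eps_rep = gen_rep (\<lambda>i v. 0) (\<lambda>v. 0)"

subsection \<open>The representation on the tensor power of the square-summable sequences\<close>

text \<open>
  \<^typ>\<open>nat ell2\<close> is the Hilbert space \<open>\<ell>\<^sup>2(\<nat>)\<close> and its tensor power is \<^typ>\<open>('n \<Rightarrow> nat) ell2\<close>,
  where the elementary tensor of the basis vectors indexed by \<open>m i\<close> is the basis vector indexed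
  by \<open>m\<close>. Under this identification \<open>on_factor k S\<close>, which applies a bounded operator \<open>S\<close> in the
  \<open>k\<close>-th variable of the coordinate function, is \<open>S\<close> on the \<open>k\<close>-th factor tensored with the
  identity on the others. The coordinate formulas below give
  \<open>|m\<rangle> \<mapsto> q\<^bsup>m-1\<^esup> (1 - q\<^bsup>2m\<^esup>)\<^bsup>1/2\<^esup> |m-1\<rangle>\<close> and \<open>|m\<rangle> \<mapsto> q\<^bsup>2m\<^esup> |m\<rangle>\<close> on the basis, see
  \<open>alpha_op_ket\<close> and \<open>tau_op_ket\<close>.
\<close>

definition ket :: "'i \<Rightarrow> 'i ell2" where
  "ket i = Abs_ell2 (\<lambda>j. if j = i then 1 else 0)"

definition alpha_op :: "real \<Rightarrow> nat ell2 \<Rightarrow> nat ell2" where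
  "alpha_op q f = Abs_ell2 (\<lambda>m.
     of_real (q ^ m * sqrt (1 - q ^ (2 * Suc m))) * Rep_ell2 f (Suc m))"

definition tau_op :: "real \<Rightarrow> nat ell2 \<Rightarrow> nat ell2" where
  "tau_op q f = Abs_ell2 (\<lambda>m. of_real (q ^ (2 * m)) * Rep_ell2 f m)"

text \<open>
  The power \<open>s \<ge> 0\<close> of the positive operator \<^const>\<open>tau_op\<close>; for \<open>s = 1 / 2\<close> it is its
  positive square root.
\<close>

definition tau_powr :: "real \<Rightarrow> real \<Rightarrow> nat ell2 \<Rightarrow> nat ell2" where
  "tau_powr q s f = Abs_ell2 (\<lambda>m. of_real ((q ^ (2 * m)) powr s) * Rep_ell2 f m)"

definition on_factor ::
    "'n \<Rightarrow> (nat ell2 \<Rightarrow> nat ell2) \<Rightarrow> ('n \<Rightarrow> nat) ell2 \<Rightarrow> ('n \<Rightarrow> nat) ell2" where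
  "on_factor k S f =
     Abs_ell2 (\<lambda>m. Rep_ell2 (S (Abs_ell2 (\<lambda>j. Rep_ell2 f (m(k := j))))) (m k))"

definition M_exp :: "'n::linorder \<Rightarrow> 'n \<Rightarrow> real" where
  "M_exp i k = (if i = k then 0 else if i < k then 1 else 1 / 2)"

definition sigma_a ::
    "real \<Rightarrow> 'n::{finite,linorder} \<Rightarrow> ('n \<Rightarrow> nat) ell2 \<Rightarrow> ('n \<Rightarrow> nat) ell2" where
  "sigma_a q i = on_factor i (alpha_op q) \<circ>
     foldr (\<lambda>k F. on_factor k (tau_powr q (M_exp i k)) \<circ> F) (sorted_list_of_set UNIV) id"

definition sigma_t :: "real \<Rightarrow> ('n::{finite,linorder} \<Rightarrow> nat) ell2 \<Rightarrow> ('n \<Rightarrow> nat) ell2" where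
  "sigma_t q = foldr (\<lambda>k F. on_factor k (tau_op q) \<circ> F) (sorted_list_of_set UNIV) id"

definition sigma_rep ::
    "real \<Rightarrow> 'n::{finite,linorder} star_term set \<Rightarrow> ('n \<Rightarrow> nat) ell2 \<Rightarrow> ('n \<Rightarrow> nat) ell2" where
  "sigma_rep q = gen_rep (sigma_a q) (sigma_t q)"

subsection \<open>Well-definedness\<close>

definition adjointable :: "('h::complex_inner \<Rightarrow> 'h) \<Rightarrow> bool" where
  "adjointable F \<longleftrightarrow> bounded_clinear F \<and> (\<exists>G. bounded_clinear G \<and> is_adjoint F G)"

lemma is_adjoint_sym: "is_adjoint F G \<Longrightarrow> is_adjoint G F"
  unfolding is_adjoint_def by (intro allI, subst (1 2) cinner_commute) simp

lemma is_adjoint_unique: "is_adjoint F G \<Longrightarrow> is_adjoint F G' \<Longrightarrow> G = G'"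
  unfolding is_adjoint_def by (rule ext, rule cinner_ext) simp

lemma cadjoint_eqI: "is_adjoint F G \<Longrightarrow> cadjoint F = G"
  unfolding cadjoint_def by (rule the_equality) (auto intro: is_adjoint_unique)

lemma adjointable_cadjoint:
  assumes "adjointable F"
  shows "is_adjoint F (cadjoint F)" "bounded_clinear (cadjoint F)" "adjointable (cadjoint F)"
proof -
  obtain G where F: "bounded_clinear F" and G: "bounded_clinear G" "is_adjoint F G"
    using assms by (auto simp: adjointable_def)
  then have "cadjoint F = G" by (simp add: cadjoint_eqI)
  moreover have "is_adjoint G F" using G(2) by (rule is_adjoint_sym)
  ultimately show "is_adjoint F (cadjoint F)" "bounded_clinear (cadjoint F)"
      "adjointable (cadjoint F)"
    using F G unfolding adjointable_def by blast+
qed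

lemma bounded_clinear_zero: "bounded_clinear (\<lambda>v. 0)"
  by (simp add: bounded_clinear_def scaleC_zero_right)

lemma bounded_clinear_id: "bounded_clinear id"
  by (simp add: bounded_clinear_def id_def bounded_linear_ident)

lemma adjointable_zero: "adjointable (\<lambda>v. 0)"
  unfolding adjointable_def
  by (intro conjI exI[of _ "\<lambda>v. 0"] bounded_clinear_zero) (simp add: is_adjoint_def)

lemma adjointable_id: "adjointable id"
  unfolding adjointable_def
  by (intro conjI exI[of _ id] bounded_clinear_id) (simp add: is_adjoint_def)

lemma bounded_clinear_add:
  "bounded_clinear F \<Longrightarrow> bounded_clinear G \<Longrightarrow> bounded_clinear (\<lambda>v. F v + G v)"
  by (simp add: bounded_clinear_def bounded_linear_add scaleC_add_right)

lemma bounded_clinear_comp: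
  "bounded_clinear F \<Longrightarrow> bounded_clinear G \<Longrightarrow> bounded_clinear (F \<circ> G)"
  by (simp add: bounded_clinear_def bounded_linear_compose comp_def)

lemma bounded_clinear_scaleC:
  fixes F :: "'a::complex_inner \<Rightarrow> 'b::complex_inner"
  assumes "bounded_clinear F"
  shows "bounded_clinear (\<lambda>v. c *\<^sub>C F v)"
proof -
  have "bounded_linear (\<lambda>v::'b. c *\<^sub>C v)"
    by (rule bounded_linear_intro[where K = "cmod c"])
      (simp_all add: scaleC_add_right scaleR_scaleC scaleC_scaleC norm_scaleC mult_ac)
  from bounded_linear_compose[OF this, of F] assms show ?thesis
    by (simp add: bounded_clinear_def scaleC_scaleC mult.commute)
qed

lemma is_adjoint_add:
  "is_adjoint F F' \<Longrightarrow> is_adjoint G G' \<Longrightarrow> is_adjoint (\<lambda>v. F v + G v) (\<lambda>v. F' v + G' v)"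
  by (simp add: is_adjoint_def cinner_add_left cinner_add_right)

lemma is_adjoint_comp: "is_adjoint F F' \<Longrightarrow> is_adjoint G G' \<Longrightarrow> is_adjoint (F \<circ> G) (G' \<circ> F')"
  by (simp add: is_adjoint_def)

lemma is_adjoint_scaleC: "is_adjoint F F' \<Longrightarrow> is_adjoint (\<lambda>v. c *\<^sub>C F v) (\<lambda>v. cnj c *\<^sub>C F' v)"
  by (simp add: is_adjoint_def cinner_scaleC_left cinner_scaleC_right)

lemma adjointable_add:
  assumes "adjointable F" "adjointable G"
  shows "adjointable (\<lambda>v. F v + G v)"
proof -
  obtain F' G' where "bounded_clinear F'" "is_adjoint F F'" "bounded_clinear G'" "is_adjoint G G'"
    using assms unfolding adjointable_def by blast
  with assms show ?thesis
    unfolding adjointable_def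
    by (intro conjI exI[of _ "\<lambda>v. F' v + G' v"] bounded_clinear_add is_adjoint_add) simp_all
qed

lemma adjointable_comp:
  assumes "adjointable F" "adjointable G"
  shows "adjointable (F \<circ> G)"
proof -
  obtain F' G' where "bounded_clinear F'" "is_adjoint F F'" "bounded_clinear G'" "is_adjoint G G'"
    using assms unfolding adjointable_def by blast
  with assms show ?thesis
    unfolding adjointable_def
    by (intro conjI exI[of _ "G' \<circ> F'"] bounded_clinear_comp is_adjoint_comp) simp_all
qed

lemma adjointable_scaleC:
  assumes "adjointable F"
  shows "adjointable (\<lambda>v. c *\<^sub>C F v)"
proof -
  obtain F' where "bounded_clinear F'" "is_adjoint F F'"
    using assms unfolding adjointable_def by blast
  with assms show ?thesis
    unfolding adjointable_def
    by (intro conjI exI[of _ "\<lambda>v. cnj c *\<^sub>C F' v"] bounded_clinear_scaleC is_adjoint_scaleC)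
      simp_all
qed

lemma adjointable_eval_term:
  assumes "\<And>i. adjointable (a i)" "adjointable t"
  shows "adjointable (eval_term a t x)"
proof (induction x)
  case (TA i)
  show ?case unfolding eval_term.simps by (rule assms(1))
next
  case TT
  show ?case unfolding eval_term.simps by (rule assms(2))
next
  case TZero
  show ?case unfolding eval_term.simps by (rule adjointable_zero)
next
  case TOne
  show ?case unfolding eval_term.simps by (rule adjointable_id)
next
  case (TAdd x y)
  then show ?case unfolding eval_term.simps by (rule adjointable_add)
next
  case (TMult x y)
  then show ?case unfolding eval_term.simps by (rule adjointable_comp)
next
  case (TScale c x)
  then show ?case unfolding eval_term.simps by (rule adjointable_scaleC)
next
  case (TStar x)
  then show ?case unfolding eval_term.simps by (rule adjointable_cadjoint(3))
qed

lemma eval_term_sum: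
  "eval_term a t (term_sum s I) v = (\<Sum>i\<in>I. eval_term a t (s i) v)"
proof -
  have "eval_term a t (foldr (\<lambda>i. TAdd (s i)) is TZero) v = (\<Sum>i\<leftarrow>is. eval_term a t (s i) v)" for "is"
    by (induction "is") simp_all
  then show ?thesis
    by (simp add: term_sum_def sum_list_distinct_conv_sum_set)
qed

locale pol_generators =
  fixes q :: real and a :: "'n::{finite,linorder} \<Rightarrow> 'h::chilbert_space \<Rightarrow> 'h" and b t
  assumes a_bounded: "\<And>i. bounded_clinear (a i)"
    and b_bounded: "\<And>i. bounded_clinear (b i)"
    and t_bounded: "bounded_clinear t"
    and a_adjoint: "\<And>i. is_adjoint (a i) (b i)"
    and t_adjoint: "is_adjoint t t"
    and a_t: "\<And>i v. a i (t v) = of_real (q\<^sup>2) *\<^sub>C t (a i v)"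
    and a_a: "\<And>i j v. i < j \<Longrightarrow> a i (a j v) = of_real (inverse q) *\<^sub>C a j (a i v)"
    and a_b: "\<And>i j v. i < j \<Longrightarrow> a i (b j v) = of_real (q ^ 3) *\<^sub>C b j (a i v)"
    and a_b_same: "\<And>i v. a i (b i v) = of_real (q\<^sup>2) *\<^sub>C b i (a i v) +
      of_real (q\<^sup>2 * (1 - q\<^sup>2)) *\<^sub>C (\<Sum>l | l < i. b l (a l v)) + of_real (1 - q\<^sup>2) *\<^sub>C t (t v)"
    and sphere: "\<And>v. (\<Sum>i\<in>UNIV. of_real (q\<^sup>2) *\<^sub>C b i (a i v)) = t v - t (t v)"
begin

lemma adjointable_eval: "adjointable (eval_term a t x)"
  by (rule adjointable_eval_term)
    (use a_bounded b_bounded t_bounded a_adjoint t_adjoint in \<open>auto simp: adjointable_def\<close>)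

lemma adjoint_eval: "is_adjoint (eval_term a t x) (cadjoint (eval_term a t x))"
  by (rule adjointable_cadjoint(1)) (rule adjointable_eval)

lemma bounded_eval: "bounded_clinear (eval_term a t x)"
  using adjointable_eval by (simp add: adjointable_def)

lemma cadjoint_a: "cadjoint (a i) = b i"
  by (rule cadjoint_eqI) (rule a_adjoint)

lemma cadjoint_t: "cadjoint t = t"
  by (rule cadjoint_eqI) (rule t_adjoint)

lemma eval_linear:
  "eval_term a t x (v + w) = eval_term a t x v + eval_term a t x w"
  "eval_term a t x (c *\<^sub>C v) = c *\<^sub>C eval_term a t x v"
  using adjointable_eval[of x]
  by (auto simp: adjointable_def bounded_clinear_def bounded_linear_def linear_add)

lemma eval_cong: "pol_eq q x y \<Longrightarrow> eval_term a t x = eval_term a t y"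
proof (induction rule: pol_eq.induct)
  case (cong_star x x')
  then show ?case by simp
next
  case rel_sphere
  show ?case
    using sphere by (auto simp: fun_eq_iff cadjoint_a eval_term_sum scaleC_minus_one)
next
  case (star_star x)
  show ?case
    using is_adjoint_sym[OF adjoint_eval[of x]] by (simp add: cadjoint_eqI)
next
  case (star_add x y)
  show ?case
    using is_adjoint_add[OF adjoint_eval[of x] adjoint_eval[of y]] by (simp add: cadjoint_eqI)
next
  case (star_scale c x)
  show ?case
    using is_adjoint_scaleC[OF adjoint_eval[of x]] by (simp add: cadjoint_eqI)
next
  case (star_mult x y)
  show ?case
    using is_adjoint_comp[OF adjoint_eval[of x] adjoint_eval[of y]] by (simp add: cadjoint_eqI)
qed (auto simp: fun_eq_iff eval_linear scaleC_add_right scaleC_add_left scaleC_scaleC scaleC_one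
    scaleC_minus_one cadjoint_a cadjoint_t a_t a_a a_b a_b_same sphere eval_term_sum)

lemma gen_rep_class: "gen_rep a t (pol_class q x) = eval_term a t x"
proof -
  have "(SOME y. y \<in> pol_class q x) \<in> pol_class q x"
    by (rule someI[of _ x]) (simp add: pol_class_def pol_eq.refl)
  then show ?thesis
    unfolding gen_rep_def by (metis eval_cong mem_Collect_eq pol_class_def)
qed

lemma star_representation_gen_rep: "star_representation (Pol q) (gen_rep a t)"
  unfolding star_representation_def
  by (auto simp: Pol_simps gen_rep_class bounded_eval adjoint_eval)

end

lemma eps_generators: "pol_generators q (\<lambda>i v. 0) (\<lambda>i v. 0) (\<lambda>v. 0 :: complex)"
  by unfold_locales (simp_all add: bounded_clinear_zero is_adjoint_def scaleC_zero_right)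

lemma star_representation_eps: "star_representation (Pol q) eps_rep"
  unfolding eps_rep_def by (rule pol_generators.star_representation_gen_rep[OF eps_generators])

lemma eps_rep_generators:
  "eps_rep (pol_class q (TA i)) = (\<lambda>v. 0)"
  "eps_rep (pol_class q TT) = (\<lambda>v. 0)"
  by (simp_all add: eps_rep_def pol_generators.gen_rep_class[OF eps_generators])

lemma weighted_shift_sums:
  fixes f :: "'j ell2" and c :: "'i \<Rightarrow> complex"
  assumes "inj h" "\<And>m. cmod (c m) \<le> 1" "finite F"
  shows "(\<Sum>m\<in>F. (cmod (c m * Rep_ell2 f (h m)))\<^sup>2) \<le> (norm f)\<^sup>2"
proof -
  have "(\<Sum>m\<in>F. (cmod (c m * Rep_ell2 f (h m)))\<^sup>2) \<le> (\<Sum>m\<in>F. (cmod (Rep_ell2 f (h m)))\<^sup>2)"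
    by (intro sum_mono power_mono) (simp_all add: norm_mult mult_left_le_one_le assms(2))
  also have "\<dots> = (\<Sum>m\<in>h ` F. (cmod (Rep_ell2 f m))\<^sup>2)"
    by (subst sum.reindex) (use \<open>inj h\<close> in \<open>auto intro: inj_on_subset\<close>)
  also have "\<dots> \<le> (norm f)\<^sup>2"
    by (rule sum_le_norm_ell2) (simp add: \<open>finite F\<close>)
  finally show ?thesis .
qed

lemma Rep_weighted_shift:
  assumes "inj h" "\<And>m. cmod (c m) \<le> 1"
  shows "Rep_ell2 (Abs_ell2 (\<lambda>m. c m * Rep_ell2 f (h m))) = (\<lambda>m. c m * Rep_ell2 f (h m))"
  by (rule Rep_Abs_ell2, rule ell2_bounded_sums(1), rule weighted_shift_sums[OF assms])

lemma bounded_clinear_ell2I: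
  fixes S :: "'j ell2 \<Rightarrow> 'i ell2"
  assumes add: "\<And>f g m. Rep_ell2 (S (f + g)) m = Rep_ell2 (S f) m + Rep_ell2 (S g) m"
    and scale: "\<And>a f m. Rep_ell2 (S (a *\<^sub>C f)) m = a * Rep_ell2 (S f) m"
    and bound: "\<And>f F. finite F \<Longrightarrow> (\<Sum>m\<in>F. (cmod (Rep_ell2 (S f) m))\<^sup>2) \<le> (norm f)\<^sup>2"
  shows "bounded_clinear S"
proof -
  have 1: "S (f + g) = S f + S g" for f g
    by (rule ell2_eqI) (simp add: add Rep_ell2_simps)
  have 2: "S (a *\<^sub>C f) = a *\<^sub>C S f" for a f
    by (rule ell2_eqI) (simp add: scale Rep_ell2_simps)
  have "(norm (S f))\<^sup>2 \<le> (norm f)\<^sup>2" for f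
    using ell2_bounded_sums(2)[of "Rep_ell2 (S f)", OF bound] by (simp add: Rep_ell2_inverse)
  then have "norm (S f) \<le> norm f" for f
    by (rule power2_le_imp_le) simp
  then have "bounded_linear S"
    by (intro bounded_linear_intro[where K = 1]) (simp_all add: 1 2 scaleR_scaleC)
  with 2 show ?thesis by (simp add: bounded_clinear_def)
qed

lemma weighted_shift_adjoint:
  fixes S :: "'j ell2 \<Rightarrow> 'i ell2" and c :: "'i \<Rightarrow> complex"
  assumes h: "inj h" and c: "\<And>m. cmod (c m) \<le> 1"
    and S: "\<And>f m. Rep_ell2 (S f) m = c m * Rep_ell2 f (h m)"
    and T: "\<And>g m. Rep_ell2 (T g) (h m) = cnj (c m) * Rep_ell2 g m"
    and T0: "\<And>g m. m \<notin> range h \<Longrightarrow> Rep_ell2 (T g) m = 0"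
  shows "bounded_clinear S" "bounded_clinear T" "is_adjoint S T"
proof -
  show "bounded_clinear S"
    by (rule bounded_clinear_ell2I)
      (simp_all add: S Rep_ell2_simps algebra_simps weighted_shift_sums[OF h c])
  show "bounded_clinear T"
  proof (rule bounded_clinear_ell2I)
    show "Rep_ell2 (T (f + g)) m = Rep_ell2 (T f) m + Rep_ell2 (T g) m" for f g m
      by (cases "m \<in> range h") (auto simp: T T0 Rep_ell2_simps algebra_simps)
    show "Rep_ell2 (T (a *\<^sub>C f)) m = a * Rep_ell2 (T f) m" for a f m
      by (cases "m \<in> range h") (auto simp: T T0 Rep_ell2_simps)
    fix g F assume F: "finite (F :: 'j set)"
    have fin: "finite (h -` F)" using F h by (simp add: finite_vimageI)
    have "(\<Sum>m\<in>F. (cmod (Rep_ell2 (T g) m))\<^sup>2) = (\<Sum>m\<in>h ` (h -` F). (cmod (Rep_ell2 (T g) m))\<^sup>2)"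
      by (rule sum.mono_neutral_right) (use F T0 in auto)
    also have "\<dots> = (\<Sum>m\<in>h -` F. (cmod (cnj (c m) * Rep_ell2 g (id m)))\<^sup>2)"
      by (subst sum.reindex) (use h in \<open>auto simp: T intro: inj_on_subset\<close>)
    also have "\<dots> \<le> (norm g)\<^sup>2"
      by (rule weighted_shift_sums) (simp_all add: c fin)
    finally show "(\<Sum>m\<in>F. (cmod (Rep_ell2 (T g) m))\<^sup>2) \<le> (norm g)\<^sup>2" .
  qed
  show "is_adjoint S T"
    unfolding is_adjoint_def
  proof (intro allI)
    fix f g
    have "cinner f (T g) = (\<Sum>\<^sub>\<infinity>m\<in>range h. cnj (Rep_ell2 f m) * Rep_ell2 (T g) m)"
      unfolding cinner_ell2_def by (rule infsum_cong_neutral) (auto simp: T0)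
    also have "\<dots> = (\<Sum>\<^sub>\<infinity>m. cnj (Rep_ell2 (S f) m) * Rep_ell2 g m)"
      by (subst infsum_reindex[OF h]) (simp add: o_def S T mult_ac)
    finally show "cinner (S f) g = cinner f (T g)"
      by (simp add: cinner_ell2_def)
  qed
qed

lemma Rep_ket: "Rep_ell2 (ket i) j = (if j = i then 1 else 0)"
proof -
  have "(\<lambda>j. (cmod (if j = i then 1 else 0))\<^sup>2) summable_on UNIV"
    by (rule summable_on_cong_neutral[THEN iffD1, of _ "{i}" _ "\<lambda>_. 1"]) auto
  then show ?thesis by (simp add: ket_def Rep_Abs_ell2)
qed

definition alpha_coeff :: "real \<Rightarrow> nat \<Rightarrow> real" where
  "alpha_coeff q m = q ^ m * sqrt (1 - q ^ (2 * Suc m))"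

definition sigma_coeff :: "real \<Rightarrow> 'n::{finite,linorder} \<Rightarrow> ('n \<Rightarrow> nat) \<Rightarrow> real" where
  "sigma_coeff q i m = alpha_coeff q (m i) * (\<Prod>k\<in>UNIV. (q ^ (2 * m k)) powr M_exp i k)"

definition total_coeff :: "real \<Rightarrow> ('n::finite \<Rightarrow> nat) \<Rightarrow> real" where
  "total_coeff q m = (\<Prod>k\<in>UNIV. q ^ (2 * m k))"

definition sq_weight :: "('n::linorder \<Rightarrow> real) \<Rightarrow> 'n \<Rightarrow> 'n \<Rightarrow> real" where
  "sq_weight x l k = (if k = l then 1 else if l < k then (x k)\<^sup>2 else x k)"

definition sigma_b ::
    "real \<Rightarrow> 'n::{finite,linorder} \<Rightarrow> ('n \<Rightarrow> nat) ell2 \<Rightarrow> ('n \<Rightarrow> nat) ell2" where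
  "sigma_b q i g = Abs_ell2 (\<lambda>m. if m i = 0 then 0
     else of_real (sigma_coeff q i (m(i := m i - 1))) * Rep_ell2 g (m(i := m i - 1)))"

abbreviation raise :: "'n \<Rightarrow> ('n \<Rightarrow> nat) \<Rightarrow> 'n \<Rightarrow> nat" where
  "raise i m \<equiv> m(i := Suc (m i))"

lemma inj_raise: "inj (raise i)"
proof (rule injI)
  fix m m' :: "'a \<Rightarrow> nat" assume eq: "raise i m = raise i m'"
  show "m = m'"
  proof
    fix k show "m k = m' k"
      using fun_cong[OF eq, of k] by (cases "k = i") auto
  qed
qed

lemma range_raise: "m \<in> range (raise i) \<longleftrightarrow> m i \<noteq> 0"
proof
  assume "m i \<noteq> 0"
  then have "m = raise i (m(i := m i - 1))" by auto
  then show "m \<in> range (raise i)" by blast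
qed auto

lemma inj_slice: "inj (\<lambda>j. m(k := j))"
  by (rule injI) (metis fun_upd_same)

lemma M_exp_nonneg: "0 \<le> M_exp i k"
  by (simp add: M_exp_def)

context
  fixes q :: real
  assumes q: "0 < q" "q < 1"
begin

lemma q_power_bounds: "0 < q ^ k" "q ^ k \<le> 1"
  using q by (simp_all add: power_le_one)

lemma alpha_coeff_bounds: "0 \<le> alpha_coeff q m" "alpha_coeff q m \<le> 1"
proof -
  have "sqrt (1 - q ^ (2 * Suc m)) \<le> 1" "0 \<le> sqrt (1 - q ^ (2 * Suc m))"
    using q_power_bounds[of "2 * Suc m"] by simp_all
  then show "0 \<le> alpha_coeff q m" "alpha_coeff q m \<le> 1"
    unfolding alpha_coeff_def using q_power_bounds[of m] by (simp_all add: mult_le_one)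
qed

lemma tau_coeff_bounds: "0 \<le> (q ^ k) powr s" "0 \<le> s \<Longrightarrow> (q ^ k) powr s \<le> 1"
  using q_power_bounds[of k] by (simp_all add: powr_le1)

lemma Rep_alpha_op: "Rep_ell2 (alpha_op q f) m = of_real (alpha_coeff q m) * Rep_ell2 f (Suc m)"
  unfolding alpha_op_def alpha_coeff_def[symmetric]
  by (subst Rep_weighted_shift) (use alpha_coeff_bounds in auto)

lemma Rep_tau_powr:
  "0 \<le> s \<Longrightarrow> Rep_ell2 (tau_powr q s f) m = of_real ((q ^ (2 * m)) powr s) * Rep_ell2 f m"
  unfolding tau_powr_def
  by (subst Rep_weighted_shift[where h = "\<lambda>m. m"]) (use tau_coeff_bounds in auto)

lemma tau_powr_one: "tau_powr q 1 = tau_op q"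
  using q_power_bounds by (simp add: fun_eq_iff tau_powr_def tau_op_def)

lemma tau_powr_half: "tau_powr q (1 / 2) \<circ> tau_powr q (1 / 2) = tau_op q"
  unfolding tau_powr_one[symmetric]
  by (rule ext, rule ell2_eqI)
    (use q_power_bounds in \<open>simp add: Rep_tau_powr mult.assoc[symmetric] flip: of_real_mult powr_add\<close>)

lemma alpha_op_ket:
  "alpha_op q (ket 0) = 0"
  "alpha_op q (ket (Suc m)) = of_real (q ^ m * sqrt (1 - q ^ (2 * Suc m))) *\<^sub>C ket m"
  by (rule ell2_eqI, simp add: Rep_alpha_op Rep_ket Rep_ell2_simps alpha_coeff_def)+

lemma tau_op_ket: "tau_op q (ket m) = of_real (q ^ (2 * m)) *\<^sub>C ket m"
  unfolding tau_powr_one[symmetric]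
  by (rule ell2_eqI)
    (use q_power_bounds in \<open>simp add: Rep_tau_powr Rep_ket Rep_ell2_simps\<close>)

lemma Rep_slice: "Rep_ell2 (Abs_ell2 (\<lambda>j. Rep_ell2 f (m(k := j)))) = (\<lambda>j. Rep_ell2 f (m(k := j)))"
  using Rep_weighted_shift[OF inj_slice, where c = "\<lambda>_. 1"] by simp

lemma Rep_on_factor_alpha:
  "Rep_ell2 (on_factor i (alpha_op q) f) m = of_real (alpha_coeff q (m i)) * Rep_ell2 f (raise i m)"
  unfolding on_factor_def Rep_alpha_op Rep_slice
  by (subst Rep_weighted_shift[OF inj_raise]) (use alpha_coeff_bounds in auto)

lemma Rep_on_factor_tau_powr:
  "0 \<le> s \<Longrightarrow> Rep_ell2 (on_factor k (tau_powr q s) f) m =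
     of_real ((q ^ (2 * m k)) powr s) * Rep_ell2 f m"
  by (simp only: on_factor_def Rep_tau_powr Rep_slice fun_upd_triv,
      subst Rep_weighted_shift[where h = "\<lambda>m. m"]) (use tau_coeff_bounds in auto)

lemma Rep_tau_prod:
  fixes e :: "'n::{finite,linorder} \<Rightarrow> real"
  assumes "\<And>k. 0 \<le> e k"
  shows "Rep_ell2 (foldr (\<lambda>k F. on_factor k (tau_powr q (e k)) \<circ> F) (sorted_list_of_set UNIV) id f) m =
    of_real (\<Prod>k\<in>UNIV. (q ^ (2 * m k)) powr e k) * Rep_ell2 f m"
proof -
  have "Rep_ell2 (foldr (\<lambda>k F. on_factor k (tau_powr q (e k)) \<circ> F) ks id f) m =
      of_real (\<Prod>k\<leftarrow>ks. (q ^ (2 * m k)) powr e k) * Rep_ell2 f m" for ks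
    by (induction ks) (simp_all add: Rep_on_factor_tau_powr assms)
  then show ?thesis
    by (simp add: prod.distinct_set_conv_list[symmetric])
qed

lemma Rep_sigma_a:
  "Rep_ell2 (sigma_a q i f) m = of_real (sigma_coeff q i m) * Rep_ell2 f (raise i m)"
proof -
  have "(\<Prod>k\<in>UNIV. (q ^ (2 * raise i m k)) powr M_exp i k) =
      (\<Prod>k\<in>UNIV. (q ^ (2 * m k)) powr M_exp i k)"
    by (rule prod.cong) (use q in \<open>auto simp: M_exp_def\<close>)
  then show ?thesis
    by (simp add: sigma_a_def sigma_coeff_def Rep_on_factor_alpha Rep_tau_prod M_exp_nonneg)
qed

lemma Rep_sigma_t: "Rep_ell2 (sigma_t q f) m = of_real (total_coeff q m) * Rep_ell2 f m"
  using Rep_tau_prod[of "\<lambda>_. 1" f m] q_power_bounds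
  by (simp add: sigma_t_def tau_powr_one total_coeff_def)

lemma sigma_coeff_bounds: "0 \<le> sigma_coeff q i m" "sigma_coeff q i m \<le> 1"
proof -
  have "0 \<le> (\<Prod>k\<in>UNIV. (q ^ (2 * m k)) powr M_exp i k)"
    by (rule prod_nonneg) simp
  moreover have "(\<Prod>k\<in>UNIV. (q ^ (2 * m k)) powr M_exp i k) \<le> 1"
    by (rule prod_le_1) (use tau_coeff_bounds M_exp_nonneg in auto)
  ultimately show "0 \<le> sigma_coeff q i m" "sigma_coeff q i m \<le> 1"
    unfolding sigma_coeff_def using alpha_coeff_bounds[of "m i"] by (simp_all add: mult_le_one)
qed

lemma norm_sigma_coeff: "cmod (of_real (sigma_coeff q i m)) \<le> 1"
  using sigma_coeff_bounds[of i m] by simp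

lemma total_coeff_bounds: "0 \<le> total_coeff q m" "total_coeff q m \<le> 1"
proof -
  show "0 \<le> total_coeff q m"
    unfolding total_coeff_def by (rule prod_nonneg) (use q in simp)
  show "total_coeff q m \<le> 1"
    unfolding total_coeff_def by (rule prod_le_1) (use q q_power_bounds in auto)
qed

lemma norm_total_coeff: "cmod (of_real (total_coeff q m)) \<le> 1"
  using total_coeff_bounds[of m] by simp

lemma Rep_sigma_b_raw: "Rep_ell2 (sigma_b q i g) = (\<lambda>m. if m i = 0 then 0
     else of_real (sigma_coeff q i (m(i := m i - 1))) * Rep_ell2 g (m(i := m i - 1)))"
  (is "_ = ?k")
proof -
  have "(\<Sum>m\<in>F. (cmod (?k m))\<^sup>2) \<le> (norm g)\<^sup>2" if F: "finite F" for F
  proof -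
    have fin: "finite (raise i -` F)" using F inj_raise by (rule finite_vimageI)
    have "(\<Sum>m\<in>F. (cmod (?k m))\<^sup>2) = (\<Sum>m\<in>raise i ` (raise i -` F). (cmod (?k m))\<^sup>2)"
    proof (rule sum.mono_neutral_right)
      show "\<forall>m\<in>F - raise i ` (raise i -` F). (cmod (?k m))\<^sup>2 = 0"
      proof
        fix m assume "m \<in> F - raise i ` (raise i -` F)"
        then have "m \<notin> range (raise i)" by auto
        then show "(cmod (?k m))\<^sup>2 = 0" by (simp add: range_raise)
      qed
    qed (use F in auto)
    also have "\<dots> = (\<Sum>m\<in>raise i -` F. (cmod (of_real (sigma_coeff q i m) * Rep_ell2 g (id m)))\<^sup>2)"
      by (subst sum.reindex) (auto intro: inj_on_subset[OF inj_raise])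
    also have "\<dots> \<le> (norm g)\<^sup>2"
      by (rule weighted_shift_sums) (simp_all only: inj_on_id fin norm_sigma_coeff)
    finally show ?thesis .
  qed
  then show ?thesis
    unfolding sigma_b_def by (intro Rep_Abs_ell2 ell2_bounded_sums(1))
qed

lemma Rep_sigma_b:
  "Rep_ell2 (sigma_b q i g) (raise i m) = of_real (sigma_coeff q i m) * Rep_ell2 g m"
  "m i = 0 \<Longrightarrow> Rep_ell2 (sigma_b q i g) m = 0"
  by (simp_all add: Rep_sigma_b_raw)

lemma sigma_coeff_raise:
  assumes "k \<noteq> i"
  shows "sigma_coeff q i (raise k m) = (q\<^sup>2) powr M_exp i k * sigma_coeff q i m"
proof -
  have "(\<Prod>l\<in>UNIV - {k}. (q ^ (2 * raise k m l)) powr M_exp i l) =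
      (\<Prod>l\<in>UNIV - {k}. (q ^ (2 * m l)) powr M_exp i l)"
    by (rule prod.cong) auto
  moreover have "(q ^ (2 * Suc (m k))) powr M_exp i k =
      (q\<^sup>2) powr M_exp i k * (q ^ (2 * m k)) powr M_exp i k"
    by (subst powr_mult[symmetric])
      (use q_power_bounds[of 2] q_power_bounds[of "2 * m k"] in \<open>auto simp: power_add power2_eq_square mult_ac\<close>)
  ultimately show ?thesis
    using assms by (simp add: sigma_coeff_def prod.remove[of UNIV k])
qed

lemma total_coeff_raise: "total_coeff q (raise k m) = q\<^sup>2 * total_coeff q m"
proof -
  have "(\<Prod>l\<in>UNIV - {k}. q ^ (2 * raise k m l)) = (\<Prod>l\<in>UNIV - {k}. q ^ (2 * m l))"
    by (rule prod.cong) auto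
  then show ?thesis
    by (simp add: total_coeff_def prod.remove[of UNIV k] power_add power2_eq_square)
qed

lemma sq_weight_sum:
  fixes x :: "'n::linorder \<Rightarrow> real"
  assumes "finite S"
  shows "(\<Sum>l\<in>S. x l * (1 - x l) * (\<Prod>k\<in>S. sq_weight x l k)) = (\<Prod>k\<in>S. x k) - (\<Prod>k\<in>S. (x k)\<^sup>2)"
  using assms
proof (induction rule: finite_linorder_max_induct)
  case (insert b S)
  have b: "b \<notin> S" using insert.hyps by auto
  have 1: "(\<Prod>k\<in>S. sq_weight x b k) = (\<Prod>k\<in>S. x k)"
    by (rule prod.cong) (use insert.hyps in \<open>auto simp: sq_weight_def\<close>)
  have 2: "(\<Sum>l\<in>S. x l * (1 - x l) * (sq_weight x l b * (\<Prod>k\<in>S. sq_weight x l k))) =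
      (x b)\<^sup>2 * (\<Sum>l\<in>S. x l * (1 - x l) * (\<Prod>k\<in>S. sq_weight x l k))"
    unfolding sum_distrib_left
    by (rule sum.cong) (use insert.hyps in \<open>auto simp: sq_weight_def\<close>)
  show ?case
    using insert.hyps b
    by (simp add: 1 2 insert.IH) (simp add: sq_weight_def power2_eq_square algebra_simps)
qed simp

lemma powr_M_exp_square:
  "(\<Prod>k\<in>UNIV. (q ^ (2 * m k)) powr M_exp i k)\<^sup>2 =
     (\<Prod>k\<in>UNIV. sq_weight (\<lambda>k. q ^ (2 * m k)) i k)"
  unfolding prod_power_distrib
proof (rule prod.cong)
  fix k
  have "((q ^ (2 * m k)) powr M_exp i k)\<^sup>2 = (q ^ (2 * m k)) powr (2 * M_exp i k)"
    using q by (simp add: power2_eq_square flip: powr_add)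
  then show "((q ^ (2 * m k)) powr M_exp i k)\<^sup>2 = sq_weight (\<lambda>k. q ^ (2 * m k)) i k"
    using q_power_bounds[of "2 * m k"] q by (auto simp: M_exp_def sq_weight_def)
qed simp

lemma sigma_coeff_square:
  "(sigma_coeff q i m)\<^sup>2 = q ^ (2 * m i) * (1 - q\<^sup>2 * q ^ (2 * m i)) *
     (\<Prod>k\<in>UNIV. sq_weight (\<lambda>k. q ^ (2 * m k)) i k)"
proof -
  have "(alpha_coeff q (m i))\<^sup>2 = q ^ (2 * m i) * (1 - q\<^sup>2 * q ^ (2 * m i))"
    using q_power_bounds[of "2 * Suc (m i)"]
    by (simp add: alpha_coeff_def power_mult_distrib power_mult[symmetric] mult.commute
        power2_eq_square[of q] mult.assoc)
  then show ?thesis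
    by (simp add: sigma_coeff_def power_mult_distrib powr_M_exp_square)
qed

lemma Rep_sigma_ba:
  "of_real (q\<^sup>2) * Rep_ell2 (sigma_b q l (sigma_a q l f)) m =
     of_real (q ^ (2 * m l) * (1 - q ^ (2 * m l)) *
       (\<Prod>k\<in>UNIV. sq_weight (\<lambda>k. q ^ (2 * m k)) l k)) * Rep_ell2 f m"
proof (cases "m l")
  case 0
  then show ?thesis by (simp add: Rep_sigma_b)
next
  case (Suc j)
  define m' where "m' = m(l := j)"
  have m: "m = raise l m'" using Suc by (auto simp: m'_def)
  have W: "(\<Prod>k\<in>UNIV. sq_weight (\<lambda>k. q ^ (2 * m' k)) l k) =
      (\<Prod>k\<in>UNIV. sq_weight (\<lambda>k. q ^ (2 * m k)) l k)"
    by (rule prod.cong) (auto simp: sq_weight_def m'_def)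
  have x: "q ^ (2 * m l) = q\<^sup>2 * q ^ (2 * m' l)"
    by (simp add: m power_add power2_eq_square)
  have "of_real (q\<^sup>2) * Rep_ell2 (sigma_b q l (sigma_a q l f)) m =
      of_real (q\<^sup>2 * (sigma_coeff q l m')\<^sup>2) * Rep_ell2 f m"
    by (simp only: m Rep_sigma_b Rep_sigma_a power2_eq_square[of "sigma_coeff q l m'"]
        of_real_mult mult.assoc)
  then show ?thesis
    by (simp only: sigma_coeff_square W x mult.assoc)
qed

lemma Rep_sum_ell2: "Rep_ell2 (\<Sum>i\<in>I. f i) m = (\<Sum>i\<in>I. Rep_ell2 (f i) m)"
  by (induction I rule: infinite_finite_induct) (simp_all add: Rep_ell2_simps)

lemma sq_weight_partial:
  fixes m :: "'n::{finite,linorder} \<Rightarrow> nat" and i :: 'n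
  defines "x \<equiv> \<lambda>k. q ^ (2 * m k)"
  shows "(\<Sum>l | l < i. x l * (1 - x l) * (\<Prod>k\<in>UNIV. sq_weight x l k)) =
    (x i)\<^sup>2 * (\<Prod>k\<in>UNIV. sq_weight x i k) - (total_coeff q m)\<^sup>2"
proof -
  define L where "L = {l. l < i}"
  define c where "c = (\<Prod>k\<in>- L. (x k)\<^sup>2)"
  have split: "(\<Prod>k\<in>UNIV. f k) = (\<Prod>k\<in>L. f k) * (\<Prod>k\<in>- L. f k)" for f :: "'n \<Rightarrow> real"
    using prod.union_disjoint[of L "- L" f] by simp
  have "(\<Prod>k\<in>UNIV. sq_weight x l k) = (\<Prod>k\<in>L. sq_weight x l k) * c" if "l \<in> L" for l
  proof -
    have "(\<Prod>k\<in>- L. sq_weight x l k) = c"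
      unfolding c_def by (rule prod.cong) (use that in \<open>auto simp: sq_weight_def L_def\<close>)
    then show ?thesis by (simp add: split)
  qed
  then have "(\<Sum>l\<in>L. x l * (1 - x l) * (\<Prod>k\<in>UNIV. sq_weight x l k)) =
      c * (\<Sum>l\<in>L. x l * (1 - x l) * (\<Prod>k\<in>L. sq_weight x l k))"
    by (simp add: sum_distrib_left mult_ac)
  also have "\<dots> = c * (\<Prod>k\<in>L. x k) - c * (\<Prod>k\<in>L. (x k)\<^sup>2)"
    by (subst sq_weight_sum) (simp_all add: algebra_simps)
  also have "c * (\<Prod>k\<in>L. (x k)\<^sup>2) = (total_coeff q m)\<^sup>2"
    using split[of "\<lambda>k. (x k)\<^sup>2"] by (simp add: c_def total_coeff_def x_def prod_power_distrib)
  also have "c * (\<Prod>k\<in>L. x k) = (x i)\<^sup>2 * (\<Prod>k\<in>UNIV. sq_weight x i k)"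
  proof -
    have 1: "(\<Prod>k\<in>L. sq_weight x i k) = (\<Prod>k\<in>L. x k)"
      by (rule prod.cong) (auto simp: sq_weight_def L_def)
    have i: "i \<in> - L" by (simp add: L_def)
    have "(\<Prod>k\<in>- L - {i}. sq_weight x i k) = (\<Prod>k\<in>- L - {i}. (x k)\<^sup>2)"
      by (rule prod.cong) (auto simp: sq_weight_def L_def)
    then have "(x i)\<^sup>2 * (\<Prod>k\<in>- L. sq_weight x i k) = c"
      unfolding c_def using i by (simp add: prod.remove[of "- L" i]) (simp add: sq_weight_def)
    then show ?thesis by (simp add: split 1 mult_ac)
  qed
  finally show ?thesis by (simp add: L_def)
qed

lemma sigma_generators:
  "pol_generators q (sigma_a q :: 'n::{finite,linorder} \<Rightarrow> _) (sigma_b q) (sigma_t q)"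
proof
  fix i j :: 'n and v :: "('n \<Rightarrow> nat) ell2"
  note adj = weighted_shift_adjoint[OF inj_raise, of "\<lambda>m. of_real (sigma_coeff q i m)" "sigma_a q i" i
      "sigma_b q i"]
  show "bounded_clinear (sigma_a q i)" "bounded_clinear (sigma_b q i)"
    "is_adjoint (sigma_a q i) (sigma_b q i)"
    by (rule adj; simp add: Rep_sigma_a Rep_sigma_b range_raise
        norm_sigma_coeff[simplified])+
  note adj = weighted_shift_adjoint[of "\<lambda>m. m" "\<lambda>m. of_real (total_coeff q m)"
      "sigma_t q :: ('n \<Rightarrow> nat) ell2 \<Rightarrow> _" "sigma_t q"]
  show "bounded_clinear (sigma_t q :: ('n \<Rightarrow> nat) ell2 \<Rightarrow> _)"
    "is_adjoint (sigma_t q :: ('n \<Rightarrow> nat) ell2 \<Rightarrow> _) (sigma_t q)"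
    by (rule adj; simp add: Rep_sigma_t norm_total_coeff[simplified])+
  show "sigma_a q i (sigma_t q v) = of_real (q\<^sup>2) *\<^sub>C sigma_t q (sigma_a q i v)"
    by (rule ell2_eqI)
      (simp only: Rep_scaleC_ell2 Rep_sigma_a Rep_sigma_t total_coeff_raise of_real_mult mult_ac)
  show "sigma_a q i (sigma_a q j v) = of_real (inverse q) *\<^sub>C sigma_a q j (sigma_a q i v)"
    if "i < j"
  proof (rule ell2_eqI)
    fix m :: "'n \<Rightarrow> nat"
    have 1: "sigma_coeff q j (raise i m) = q * sigma_coeff q j m"
      using that q by (auto simp: sigma_coeff_raise M_exp_def powr_half_sqrt)
    have 2: "sigma_coeff q i (raise j m) = q\<^sup>2 * sigma_coeff q i m"
      using that q by (auto simp: sigma_coeff_raise M_exp_def)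
    have 3: "raise j (raise i m) = raise i (raise j m)"
      using that by (auto simp: fun_eq_iff)
    have "inverse q * (sigma_coeff q j m * sigma_coeff q i (raise j m)) =
        sigma_coeff q i m * sigma_coeff q j (raise i m)"
      using q by (simp add: 1 2 power2_eq_square)
    moreover have "Rep_ell2 (sigma_a q i (sigma_a q j v)) m =
        of_real (sigma_coeff q i m * sigma_coeff q j (raise i m)) *
          Rep_ell2 v (raise j (raise i m))"
      by (simp only: Rep_sigma_a of_real_mult mult.assoc)
    moreover have "Rep_ell2 (of_real (inverse q) *\<^sub>C sigma_a q j (sigma_a q i v)) m =
        of_real (inverse q * (sigma_coeff q j m * sigma_coeff q i (raise j m))) *
          Rep_ell2 v (raise i (raise j m))"
      by (simp only: Rep_scaleC_ell2 Rep_sigma_a of_real_mult mult.assoc)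
    ultimately show "Rep_ell2 (sigma_a q i (sigma_a q j v)) m =
        Rep_ell2 (of_real (inverse q) *\<^sub>C sigma_a q j (sigma_a q i v)) m"
      using 3 by presburger
  qed
  show "sigma_a q i (sigma_b q j v) = of_real (q ^ 3) *\<^sub>C sigma_b q j (sigma_a q i v)"
    if "i < j"
  proof (rule ell2_eqI)
    fix m :: "'n \<Rightarrow> nat"
    show "Rep_ell2 (sigma_a q i (sigma_b q j v)) m =
        Rep_ell2 (of_real (q ^ 3) *\<^sub>C sigma_b q j (sigma_a q i v)) m"
    proof (cases "m j = 0")
      case True
      then have "raise i m j = 0" using that by simp
      then show ?thesis
        unfolding Rep_scaleC_ell2 Rep_sigma_a Rep_sigma_b(2)[where m = m and i = j, OF True]
        by (simp add: Rep_sigma_b(2))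
    next
      case False
      then have "m \<in> range (raise j)" by (simp only: range_raise not_False_eq_True)
      then obtain m' where m: "m = raise j m'" by (rule rangeE)
      have 1: "sigma_coeff q j (raise i m') = q * sigma_coeff q j m'"
        using that q by (auto simp: sigma_coeff_raise M_exp_def powr_half_sqrt)
      have 2: "sigma_coeff q i (raise j m') = q\<^sup>2 * sigma_coeff q i m'"
        using that q by (auto simp: sigma_coeff_raise M_exp_def)
      have 3: "raise i (raise j m') = raise j (raise i m')"
        using that by (auto simp: fun_eq_iff)
      have "sigma_coeff q i (raise j m') * sigma_coeff q j (raise i m') =
          q ^ 3 * (sigma_coeff q j m' * sigma_coeff q i m')"
        by (simp add: 1 2 power2_eq_square power3_eq_cube)
      moreover have "Rep_ell2 (sigma_a q i (sigma_b q j v)) m =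
          of_real (sigma_coeff q i (raise j m') * sigma_coeff q j (raise i m')) *
            Rep_ell2 v (raise i m')"
        unfolding m Rep_sigma_a 3 Rep_sigma_b(1) of_real_mult mult.assoc ..
      moreover have "Rep_ell2 (of_real (q ^ 3) *\<^sub>C sigma_b q j (sigma_a q i v)) m =
          of_real (q ^ 3 * (sigma_coeff q j m' * sigma_coeff q i m')) * Rep_ell2 v (raise i m')"
        unfolding m Rep_scaleC_ell2 Rep_sigma_b(1) Rep_sigma_a of_real_mult mult.assoc ..
      ultimately show ?thesis by simp
    qed
  qed
  show "sigma_a q i (sigma_b q i v) = of_real (q\<^sup>2) *\<^sub>C sigma_b q i (sigma_a q i v) +
      of_real (q\<^sup>2 * (1 - q\<^sup>2)) *\<^sub>C (\<Sum>l | l < i. sigma_b q l (sigma_a q l v)) +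
      of_real (1 - q\<^sup>2) *\<^sub>C sigma_t q (sigma_t q v)" (is "_ = ?rhs")
  proof (rule ell2_eqI)
    fix m :: "'n \<Rightarrow> nat"
    define x where "x = (\<lambda>k. q ^ (2 * m k))"
    define W where "W l = (\<Prod>k\<in>UNIV. sq_weight x l k)" for l :: 'n
    have ba: "of_real (q\<^sup>2) * Rep_ell2 (sigma_b q l (sigma_a q l v)) m =
        of_real (x l * (1 - x l) * W l) * Rep_ell2 v m" for l
      using Rep_sigma_ba[of l v m] by (simp only: x_def W_def)
    have "of_real (q\<^sup>2 * (1 - q\<^sup>2)) * Rep_ell2 (\<Sum>l | l < i. sigma_b q l (sigma_a q l v)) m =
        of_real (1 - q\<^sup>2) *
          (\<Sum>l | l < i. of_real (q\<^sup>2) * Rep_ell2 (sigma_b q l (sigma_a q l v)) m)"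
      by (simp add: Rep_sum_ell2 sum_distrib_left mult_ac)
    also have "\<dots> = of_real ((1 - q\<^sup>2) * (\<Sum>l | l < i. x l * (1 - x l) * W l)) * Rep_ell2 v m"
      unfolding ba by (simp only: of_real_mult of_real_sum sum_distrib_right mult.assoc)
    also have "(\<Sum>l | l < i. x l * (1 - x l) * W l) = (x i)\<^sup>2 * W i - (total_coeff q m)\<^sup>2"
      using sq_weight_partial[of m i] by (simp only: x_def W_def)
    finally have sum: "of_real (q\<^sup>2 * (1 - q\<^sup>2)) *
        Rep_ell2 (\<Sum>l | l < i. sigma_b q l (sigma_a q l v)) m =
      of_real ((1 - q\<^sup>2) * ((x i)\<^sup>2 * W i - (total_coeff q m)\<^sup>2)) * Rep_ell2 v m" .
    have tt: "of_real (1 - q\<^sup>2) * Rep_ell2 (sigma_t q (sigma_t q v)) m =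
        of_real ((1 - q\<^sup>2) * (total_coeff q m)\<^sup>2) * Rep_ell2 v m"
      by (simp add: Rep_sigma_t power2_eq_square)
    have "Rep_ell2 ?rhs m = of_real (x i * (1 - x i) * W i +
        (1 - q\<^sup>2) * ((x i)\<^sup>2 * W i - (total_coeff q m)\<^sup>2) + (1 - q\<^sup>2) * (total_coeff q m)\<^sup>2) * Rep_ell2 v m"
      unfolding Rep_plus_ell2 Rep_scaleC_ell2 ba sum tt of_real_add distrib_right ..
    also have "x i * (1 - x i) * W i + (1 - q\<^sup>2) * ((x i)\<^sup>2 * W i - (total_coeff q m)\<^sup>2) +
        (1 - q\<^sup>2) * (total_coeff q m)\<^sup>2 = x i * (1 - q\<^sup>2 * x i) * W i"
      by (simp add: power2_eq_square algebra_simps)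
    also have "\<dots> = (sigma_coeff q i m)\<^sup>2"
      by (simp only: sigma_coeff_square x_def W_def)
    also have "of_real \<dots> * Rep_ell2 v m = Rep_ell2 (sigma_a q i (sigma_b q i v)) m"
      by (simp only: Rep_sigma_a Rep_sigma_b power2_eq_square of_real_mult mult.assoc)
    finally show "Rep_ell2 (sigma_a q i (sigma_b q i v)) m = Rep_ell2 ?rhs m" ..
  qed
  show "(\<Sum>i\<in>UNIV. of_real (q\<^sup>2) *\<^sub>C sigma_b q i (sigma_a q i v)) =
      sigma_t q v - sigma_t q (sigma_t q v)"
  proof (rule ell2_eqI)
    fix m :: "'n \<Rightarrow> nat"
    have "Rep_ell2 (\<Sum>i\<in>UNIV. of_real (q\<^sup>2) *\<^sub>C sigma_b q i (sigma_a q i v)) m =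
        of_real (\<Sum>l\<in>UNIV. q ^ (2 * m l) * (1 - q ^ (2 * m l)) *
          (\<Prod>k\<in>UNIV. sq_weight (\<lambda>k. q ^ (2 * m k)) l k)) * Rep_ell2 v m"
      by (simp only: Rep_sum_ell2 Rep_scaleC_ell2 Rep_sigma_ba of_real_sum sum_distrib_right)
    also have "\<dots> = of_real (total_coeff q m - (total_coeff q m)\<^sup>2) * Rep_ell2 v m"
      by (subst sq_weight_sum) (simp_all add: total_coeff_def prod_power_distrib)
    also have "\<dots> = Rep_ell2 (sigma_t q v - sigma_t q (sigma_t q v)) m"
      by (simp add: Rep_minus_ell2 Rep_sigma_t power2_eq_square algebra_simps)
    finally show "Rep_ell2 (\<Sum>i\<in>UNIV. of_real (q\<^sup>2) *\<^sub>C sigma_b q i (sigma_a q i v)) m =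
        Rep_ell2 (sigma_t q v - sigma_t q (sigma_t q v)) m" .
  qed
qed

lemma star_representation_sigma:
  "star_representation (Pol q) (sigma_rep q :: 'n::{finite,linorder} star_term set \<Rightarrow> _)"
  unfolding sigma_rep_def by (rule pol_generators.star_representation_gen_rep[OF sigma_generators])

lemma sigma_rep_generators:
  "sigma_rep q (pol_class q (TA i)) = sigma_a q i"
  "sigma_rep q (pol_class q TT) = (sigma_t q :: ('n::{finite,linorder} \<Rightarrow> nat) ell2 \<Rightarrow> _)"
  by (simp_all add: sigma_rep_def pol_generators.gen_rep_class[OF sigma_generators])

end

end

theory Submission
  imports Defs
begin

text \<open>
  The theorem is a Stone--von Neumann argument: every irreducible representation contains a
  vacuum vector, and a vacuum vector determines an irreducible representation. Write \<open>b\<^sub>i\<close> for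
  the adjoint of \<open>a\<^sub>i\<close>.

  The sphere relation says that \<open>t - t\<^sup>2\<close> is the positive operator \<open>\<Sum>i. q\<^sup>2 b\<^sub>i a\<^sub>i\<close>, so
  \<open>0 \<le> t \<le> 1\<close>, and the relation \<open>a\<^sub>i t = q\<^sup>2 t a\<^sub>i\<close> says that the \<open>a\<^sub>i\<close> increase the eigenvalues of
  \<open>t\<close> by the factor \<open>q\<^sup>-\<^sup>2\<close>. A vector at the top of the spectrum of \<open>t\<close> should therefore be
  annihilated by all \<open>a\<^sub>i\<close>, and then by \<open>t - t\<^sup>2\<close>. No spectral theorem is used to find it: the two
  relations show that \<open>t\<^bsup>k\<^esup> v\<close> converges at the rate \<open>(q\<^sup>2 \<parallel>t\<parallel>)\<^bsup>k\<^esup>\<close>, whereas for self-adjoint \<open>t\<close> a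
  unit vector with \<open>\<parallel>t v\<parallel> > q\<^sup>2 \<parallel>t\<parallel>\<close> keeps \<open>\<parallel>t\<^bsup>k\<^esup> v\<parallel> \<ge> \<parallel>t v\<parallel>\<^bsup>k\<^esup>\<close>. So if \<open>t \<noteq> 0\<close>, the limit is a nonzero
  vector fixed by \<open>t\<close> (lemma \<open>vacuum_exists\<close>). If \<open>t = 0\<close>, then all \<open>a\<^sub>i\<close> vanish, and every vector
  is a vacuum with \<open>t\<close>-eigenvalue 0.

  For uniqueness, let two representations have unit vacuum vectors \<open>v\<close> and \<open>w\<close> with the same
  eigenvalue of \<open>t\<close>. Match the vectors obtained from \<open>v\<close> and from \<open>w\<close> by the same sequence of
  linear combinations and applications of the \<open>b\<^sub>i\<close>. The relations move every \<open>a\<^sub>i\<close> and \<open>t\<close> through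
  the \<open>b\<^sub>j\<close> to the vacuum, with coefficients that do not depend on the representation, so the
  matching respects the whole algebra; moving \<open>b\<^sub>i\<close> across the inner product as \<open>a\<^sub>i\<close> shows that it is
  isometric (lemmas \<open>corr_a\<close> and \<open>corr_cinner\<close>). When the matched vectors are dense on both sides,
  its closure is the graph of a unitary intertwiner (lemma \<open>unitary_extension\<close>). On the side of
  the given representation density is irreducibility; the vacuum \<open>1\<close> of \<open>\<epsilon>\<close>, with eigenvalue 0, and
  the vacuum \<open>|0,\<dots>,0\<rangle>\<close> of \<open>\<sigma>\<^sub>n\<close>, with eigenvalue 1, are cyclic for the \<open>b\<^sub>i\<close> by inspection.
\<close>

section \<open>Hilbert space preliminaries\<close>

lemma cinner_self: "cinner x x = complex_of_real ((norm (x :: 'a::complex_inner))\<^sup>2)"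
proof -
  have "Im (cinner x x) = 0"
    by (metis cinner_commute cnj.simps(2) neg_equal_zero)
  then show ?thesis
    by (simp add: complex_eq_iff power2_norm_eq_inner inner_eq_Re_cinner)
qed

text \<open>A complex-linear map that preserves norms preserves the real inner product by polarization,
  hence the complex one by this formula.\<close>

lemma cinner_conv_inner:
  "cinner x y = Complex (x \<bullet> y) (- (x \<bullet> (\<i> *\<^sub>C y)))" for x y :: "'a::complex_inner"
  by (simp add: complex_eq_iff inner_eq_Re_cinner cinner_scaleC_right)

lemma bounded_linear_scaleC: "bounded_linear (\<lambda>x::'a::complex_inner. c *\<^sub>C x)"
  using bounded_clinear_scaleC[OF bounded_clinear_id, of c]
  unfolding bounded_clinear_def id_def by (rule conjunct1)

lemma bounded_clinearD:
  assumes "bounded_clinear F"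
  shows "bounded_linear F" "F (x + y) = F x + F y" "F (x - y) = F x - F y" "F 0 = 0"
    "F (c *\<^sub>C x) = c *\<^sub>C F x" "F (r *\<^sub>R x) = r *\<^sub>R F x"
  using assms
  by (auto simp: bounded_clinear_def bounded_linear.linear linear_add linear_diff linear_0
      linear_scale)

lemma is_adjoint_inner: "is_adjoint F G \<Longrightarrow> F x \<bullet> y = x \<bullet> G y"
  by (simp add: is_adjoint_def inner_eq_Re_cinner)

lemma cadjoint_zero: "cadjoint (\<lambda>x. 0) = (\<lambda>y. 0)"
  by (rule cadjoint_eqI) (simp add: is_adjoint_def)

lemma cadjoint_id: "cadjoint (\<lambda>x. x) = (\<lambda>x. x)"
  by (rule cadjoint_eqI) (simp add: is_adjoint_def)

text \<open>The rate of convergence is stated explicitly because it is what shows in \<open>vacuum_exists\<close>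
  that the limit is not 0.\<close>

lemma geometric_steps_converge:
  fixes X :: "nat \<Rightarrow> 'a::banach"
  assumes step: "\<And>n. norm (X n - X (Suc n)) \<le> c * r ^ n" and r: "0 \<le> r" "r < 1"
  obtains p where "X \<longlonglongrightarrow> p" "\<And>n. norm (X n - p) \<le> c * r ^ n / (1 - r)"
proof -
  have "0 \<le> c" using order_trans[OF norm_ge_zero step[of 0]] by simp
  have far: "norm (X n - X (n + j)) \<le> c * r ^ n * (1 - r ^ j) / (1 - r)" for n j
  proof (induction j)
    case (Suc j)
    have "norm (X n - X (n + Suc j)) \<le> norm (X n - X (n + j)) + norm (X (n + j) - X (Suc (n + j)))"
      using norm_triangle_ineq[of "X n - X (n + j)" "X (n + j) - X (Suc (n + j))"] by simp
    also have "\<dots> \<le> c * r ^ n * (1 - r ^ j) / (1 - r) + c * r ^ (n + j)"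
      using Suc.IH step by (rule add_mono)
    also have "\<dots> = c * r ^ n * (1 - r ^ Suc j) / (1 - r)"
      using r by (simp add: field_simps power_add)
    finally show ?case .
  qed simp
  have tail: "norm (X n - X m) \<le> c * r ^ n / (1 - r)" if "n \<le> m" for n m
  proof -
    have "c * r ^ n * (1 - r ^ (m - n)) / (1 - r) \<le> c * r ^ n * 1 / (1 - r)"
      using r \<open>0 \<le> c\<close> by (intro divide_right_mono mult_left_mono) auto
    then show ?thesis using far[of n "m - n"] that by simp
  qed
  have small: "(\<lambda>n. c * r ^ n / (1 - r)) \<longlonglongrightarrow> 0"
    by (intro tendsto_eq_intros LIMSEQ_power_zero) (use r in auto)
  have "Cauchy X"
  proof (rule CauchyI)
    fix e :: real assume "0 < e"
    then obtain N where N: "c * r ^ N / (1 - r) < e / 2"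
      using eventually_happens'[OF _ order_tendstoD(2)[OF small, of "e / 2"]] by auto
    have "norm (X m - X n) < e" if "m \<ge> N" "n \<ge> N" for m n
    proof -
      have "norm (X m - X n) \<le> norm (X N - X n) + norm (X N - X m)"
        using norm_triangle_ineq4[of "X N - X n" "X N - X m"] by simp
      then show ?thesis using tail[OF that(1)] tail[OF that(2)] N by linarith
    qed
    then show "\<exists>M. \<forall>m\<ge>M. \<forall>n\<ge>M. norm (X m - X n) < e" by blast
  qed
  then obtain p where p: "X \<longlonglongrightarrow> p"
    using convergent_eq_Cauchy by blast
  moreover have "norm (X n - p) \<le> c * r ^ n / (1 - r)" for n
  proof (rule tendsto_upperbound)
    show "(\<lambda>m. norm (X n - X m)) \<longlonglongrightarrow> norm (X n - p)" by (intro tendsto_intros p)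
    show "\<forall>\<^sub>F m in sequentially. norm (X n - X m) \<le> c * r ^ n / (1 - r)"
      by (rule eventually_sequentiallyI[of n]) (rule tail)
  qed simp
  ultimately show ?thesis by (rule that)
qed

text \<open>
  A linear isometric relation between dense subspaces is closable, and its closure is the graph of
  a unitary: isometry makes the second component of a sequence in the relation a Cauchy sequence
  as soon as the first one is, and conversely. Continuity carries over to the unitary every pair
  of operators under which the relation is invariant.
\<close>

lemma unitary_extension:
  fixes R :: "'h::chilbert_space \<Rightarrow> 'k::chilbert_space \<Rightarrow> bool"
  assumes add: "\<And>x y x' y'. R x y \<Longrightarrow> R x' y' \<Longrightarrow> R (x + x') (y + y')"
    and scale: "\<And>c x y. R x y \<Longrightarrow> R (c *\<^sub>C x) (c *\<^sub>C y)"
    and isometric: "\<And>x y. R x y \<Longrightarrow> norm x = norm y"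
    and dom: "closure {x. \<exists>y. R x y} = UNIV"
    and ran: "closure {y. \<exists>x. R x y} = UNIV"
  obtains U where "unitary_map U"
    "\<And>F G. bounded_clinear F \<Longrightarrow> bounded_clinear G \<Longrightarrow>
      (\<And>x y. R x y \<Longrightarrow> R (F x) (G y)) \<Longrightarrow> U \<circ> F = G \<circ> U"
proof -
  define C where "C x y \<longleftrightarrow> (\<exists>X Y. (\<forall>n::nat. R (X n) (Y n)) \<and> X \<longlonglongrightarrow> x \<and> Y \<longlonglongrightarrow> y)" for x y
  have C_I: "C x y" if "\<And>n::nat. R (X n) (Y n)" "X \<longlonglongrightarrow> x" "Y \<longlonglongrightarrow> y" for X Y x y
    using that by (auto simp: C_def)
  have C_add: "C (x + x') (y + y')" if C: "C x y" "C x' y'" for x y x' y'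
  proof -
    obtain X Y where 1: "\<forall>n::nat. R (X n) (Y n)" "X \<longlonglongrightarrow> x" "Y \<longlonglongrightarrow> y"
      using C(1) unfolding C_def by blast
    obtain X' Y' where 2: "\<forall>n::nat. R (X' n) (Y' n)" "X' \<longlonglongrightarrow> x'" "Y' \<longlonglongrightarrow> y'"
      using C(2) unfolding C_def by blast
    show ?thesis
      by (rule C_I[OF add[OF 1(1)[rule_format] 2(1)[rule_format]] tendsto_add[OF 1(2) 2(2)] tendsto_add[OF 1(3) 2(3)]])
  qed
  have C_op: "C (F x) (G y)"
    if C: "C x y" and F: "bounded_linear F" and G: "bounded_linear G"
      and R: "\<And>x y. R x y \<Longrightarrow> R (F x) (G y)" for F G x y
  proof -
    obtain X Y where 1: "\<forall>n::nat. R (X n) (Y n)" "X \<longlonglongrightarrow> x" "Y \<longlonglongrightarrow> y"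
      using C unfolding C_def by blast
    show ?thesis
      by (rule C_I[OF R[OF 1(1)[rule_format]] bounded_linear.tendsto[OF F 1(2)] bounded_linear.tendsto[OF G 1(3)]])
  qed
  have C_scale: "C (c *\<^sub>C x) (c *\<^sub>C y)" if "C x y" for c x y
    using that bounded_linear_scaleC bounded_linear_scaleC scale by (rule C_op)
  have C_norm: "norm x = norm y" if C: "C x y" for x y
  proof -
    obtain X Y where XY: "\<forall>n::nat. R (X n) (Y n)" "X \<longlonglongrightarrow> x" "Y \<longlonglongrightarrow> y"
      using C unfolding C_def by blast
    have "(\<lambda>n. norm (X n)) = (\<lambda>n. norm (Y n))" using XY(1) isometric by auto
    then show ?thesis using LIMSEQ_unique tendsto_norm[OF XY(2)] tendsto_norm[OF XY(3)] by metis
  qed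
  have R_diff: "R (x - x') (y - y')" if "R x y" "R x' y'" for x y x' y'
    using add[OF that(1) scale[OF that(2), of "-1"]] by (simp add: scaleC_minus_one)
  have C_total: "\<exists>y. C x y" for x
  proof -
    have "x \<in> closure {x. \<exists>y. R x y}" by (simp add: dom)
    then obtain X where "\<forall>n. \<exists>y. R (X n) y" and X: "X \<longlonglongrightarrow> x"
      by (auto simp: closure_sequential)
    then obtain Y where Y: "\<And>n::nat. R (X n) (Y n)" by metis
    have "dist (X m) (X n) = dist (Y m) (Y n)" for m n
      unfolding dist_norm by (rule isometric) (rule R_diff[OF Y Y])
    then have "Cauchy Y" using LIMSEQ_imp_Cauchy[OF X] by (simp add: Cauchy_def)
    then obtain y where "Y \<longlonglongrightarrow> y" using convergent_eq_Cauchy by blast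
    then show ?thesis using X Y unfolding C_def by blast
  qed
  have C_onto: "\<exists>x. C x y" for y
  proof -
    have "y \<in> closure {y. \<exists>x. R x y}" by (simp add: ran)
    then obtain Y where "\<forall>n. \<exists>x. R x (Y n)" and Y: "Y \<longlonglongrightarrow> y"
      by (auto simp: closure_sequential)
    then obtain X where X: "\<And>n::nat. R (X n) (Y n)" by metis
    have "dist (X m) (X n) = dist (Y m) (Y n)" for m n
      unfolding dist_norm by (rule isometric) (rule R_diff[OF X X])
    then have "Cauchy X" using LIMSEQ_imp_Cauchy[OF Y] by (simp add: Cauchy_def)
    then obtain x where "X \<longlonglongrightarrow> x" using convergent_eq_Cauchy by blast
    then show ?thesis using X Y unfolding C_def by blast
  qed
  have C_unique: "y = y'" if "C x y" "C x y'" for x y y'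
    using C_norm[OF C_add[OF that(1) C_scale[OF that(2), of "-1"]]] by (simp add: scaleC_minus_one)
  define U where "U x = (THE y. C x y)" for x
  have U: "C x (U x)" for x
    unfolding U_def using C_total[of x] C_unique by (metis the_equality)
  have U_eq: "U x = y" if "C x y" for x y using C_unique[OF U that] .
  have U_add: "U (x + y) = U x + U y" for x y by (rule U_eq) (rule C_add[OF U U])
  have U_scale: "U (c *\<^sub>C x) = c *\<^sub>C U x" for c x by (rule U_eq) (rule C_scale[OF U])
  have U_norm: "norm (U x) = norm x" for x using C_norm[OF U[of x]] by simp
  have "bounded_linear U"
    by (rule bounded_linear_intro[where K = 1]) (simp_all add: U_add U_scale U_norm scaleR_scaleC)
  then have "bounded_clinear U" by (simp add: bounded_clinear_def U_scale)
  moreover have "surj U" using C_onto U_eq unfolding surj_def by metis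
  moreover have "cinner (U x) (U y) = cinner x y" for x y
  proof -
    have "U x \<bullet> U y = x \<bullet> y" for x y
      by (simp add: dot_norm U_norm flip: U_add)
    then show ?thesis by (simp add: cinner_conv_inner flip: U_scale)
  qed
  ultimately have "unitary_map U" by (simp add: unitary_map_def)
  moreover have "U \<circ> F = G \<circ> U" if "bounded_clinear F" "bounded_clinear G"
    "\<And>x y. R x y \<Longrightarrow> R (F x) (G y)" for F G
    using U_eq[OF C_op[OF U that(1,2)[THEN bounded_clinearD(1)] that(3)]] by (simp add: fun_eq_iff)
  ultimately show ?thesis using that by blast
qed

lemma subspace_scaleC_iff:
  "module.subspace scaleC (S :: 'a::complex_inner set) \<longleftrightarrow>
    0 \<in> S \<and> (\<forall>x\<in>S. \<forall>y\<in>S. x + y \<in> S) \<and> (\<forall>c. \<forall>x\<in>S. c *\<^sub>C x \<in> S)"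
proof -
  interpret vector_space "scaleC :: complex \<Rightarrow> 'a \<Rightarrow> 'a" by (rule vector_space_scaleC)
  show ?thesis by (rule subspace_def)
qed

lemma subspace_scaleC_closure:
  fixes S :: "'a::complex_inner set"
  assumes "module.subspace scaleC S"
  shows "module.subspace scaleC (closure S)"
  unfolding subspace_scaleC_iff
proof (intro conjI ballI allI)
  show "0 \<in> closure S" using assms closure_subset[of S] by (auto simp: subspace_scaleC_iff)
next
  fix x y assume "x \<in> closure S" "y \<in> closure S"
  then obtain X Y where "\<forall>n. X n \<in> S" "X \<longlonglongrightarrow> x" "\<forall>n. Y n \<in> S" "Y \<longlonglongrightarrow> y"
    by (auto simp: closure_sequential)
  then have "\<forall>n. X n + Y n \<in> S" "(\<lambda>n. X n + Y n) \<longlonglongrightarrow> x + y"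
    using assms by (auto simp: subspace_scaleC_iff intro: tendsto_add)
  then show "x + y \<in> closure S"
    unfolding closure_sequential by (intro exI[of _ "\<lambda>n. X n + Y n"]) simp
next
  fix c x assume "x \<in> closure S"
  then obtain X where "\<forall>n. X n \<in> S" "X \<longlonglongrightarrow> x"
    by (auto simp: closure_sequential)
  then have "\<forall>n. c *\<^sub>C X n \<in> S" "(\<lambda>n. c *\<^sub>C X n) \<longlonglongrightarrow> c *\<^sub>C x"
    using assms bounded_linear.tendsto[OF bounded_linear_scaleC]
    by (auto simp: subspace_scaleC_iff)
  then show "c *\<^sub>C x \<in> closure S"
    unfolding closure_sequential by (intro exI[of _ "\<lambda>n. c *\<^sub>C X n"]) simp
qed

lemma bounded_clinear_image_closure:
  assumes "bounded_clinear F" "F ` S \<subseteq> S"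
  shows "F ` closure S \<subseteq> closure S"
proof (rule image_closure_subset)
  show "continuous_on (closure S) F"
    using bounded_clinearD(1)[OF assms(1)] by (rule linear_continuous_on)
qed (use assms(2) closure_subset[of S] in auto)

lemma norm_ket: "norm (ket i) = 1"
proof -
  have "(norm (ket i))\<^sup>2 = (\<Sum>\<^sub>\<infinity>j\<in>{i}. 1)"
    unfolding norm_ell2_eq by (rule infsum_cong_neutral) (auto simp: Rep_ket)
  then have "(norm (ket i))\<^sup>2 = 1" by simp
  then show ?thesis by (simp add: power2_eq_1_iff) (smt (verit) norm_ge_zero)
qed

text \<open>The finite partial sums of the expansion of \<open>f\<close> in the basis leave a remainder whose norm is
  the tail of the series for \<open>\<parallel>f\<parallel>\<^sup>2\<close>.\<close>

lemma ket_total: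
  fixes S :: "'i ell2 set"
  assumes S: "module.subspace scaleC S" and kets: "\<And>m. ket m \<in> S"
  shows "closure S = UNIV"
proof -
  have "\<exists>y\<in>S. dist y f < e" if "e > 0" for f and e :: real
  proof -
    let ?c = "\<lambda>m. (cmod (Rep_ell2 f m))\<^sup>2"
    have "(?c has_sum (norm f)\<^sup>2) UNIV"
      unfolding norm_ell2_eq by (rule has_sum_infsum) (rule Rep_ell2_summable)
    from has_sum_finite_approximation[OF this, of "(e / 2)\<^sup>2"] that
    obtain F where F: "finite F" "dist (sum ?c F) ((norm f)\<^sup>2) \<le> (e / 2)\<^sup>2" by auto
    define g where "g = (\<Sum>m\<in>F. Rep_ell2 f m *\<^sub>C ket m)"
    have "g \<in> S"
      unfolding g_def using F(1) S kets by (induction F) (auto simp: subspace_scaleC_iff)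
    have Rep_g: "Rep_ell2 (f - g) m = (if m \<in> F then 0 else Rep_ell2 f m)" for m
      using F(1) by (simp add: g_def Rep_minus_ell2 Rep_sum_ell2[of "1 / 2"] Rep_scaleC_ell2 Rep_ket
          if_distrib[of "(*) _"] cong: if_cong)
    have "(\<Sum>m\<in>F'. (cmod (Rep_ell2 (f - g) m))\<^sup>2) \<le> (e / 2)\<^sup>2" if F': "finite F'" for F'
    proof -
      have "(\<Sum>m\<in>F'. (cmod (Rep_ell2 (f - g) m))\<^sup>2) = sum ?c (F' - F)"
        by (rule sum.mono_neutral_cong_right) (use F' in \<open>auto simp: Rep_g\<close>)
      also have "\<dots> = sum ?c (F \<union> F') - sum ?c F"
        using sum.union_disjoint[of F "F' - F" ?c] F(1) F' by simp
      also have "\<dots> \<le> (e / 2)\<^sup>2"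
        using sum_le_norm_ell2[of "F \<union> F'" f] F F' by (simp add: dist_real_def)
      finally show ?thesis .
    qed
    then have "(norm (f - g))\<^sup>2 \<le> (e / 2)\<^sup>2"
      using ell2_bounded_sums(2)[of "Rep_ell2 (f - g)"] by (simp add: Rep_ell2_inverse)
    then have "norm (f - g) \<le> e / 2" by (rule power2_le_imp_le) (use \<open>e > 0\<close> in simp)
    then show ?thesis using \<open>g \<in> S\<close> \<open>e > 0\<close>
      by (intro bexI[of _ g]) (auto simp: dist_norm norm_minus_commute)
  qed
  then show ?thesis by (auto simp: closure_approachable)
qed

section \<open>Representations as solutions of the relations\<close>

text \<open>
  A representation is given by the operators that solve the relations; adjoints are unique, which
  settles the terms with a star.
\<close>

lemma rep_eq_eval_term:
  fixes \<phi> :: "'n::{finite,linorder} star_term set \<Rightarrow> 'h::chilbert_space \<Rightarrow> 'h"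
  assumes rep: "star_representation (Pol q) \<phi>"
  shows "\<phi> (pol_class q x) =
    eval_term (\<lambda>i. \<phi> (pol_class q (TA i))) (\<phi> (pol_class q TT)) x"
proof -
  let ?C = "pol_class q :: 'n star_term \<Rightarrow> _"
  have one: "\<phi> (?C TOne) = id"
    and add: "\<phi> (?C (TAdd x y)) = (\<lambda>v. \<phi> (?C x) v + \<phi> (?C y) v)"
    and mult: "\<phi> (?C (TMult x y)) = \<phi> (?C x) \<circ> \<phi> (?C y)"
    and scale: "\<phi> (?C (TScale c x)) = (\<lambda>v. c *\<^sub>C \<phi> (?C x) v)"
    and star: "is_adjoint (\<phi> (?C x)) (\<phi> (?C (TStar x)))" for x y c
    using rep by (simp_all add: star_representation_def Pol_simps flip: Pol_simps(3-7))
  have "?C TZero = ?C (TAdd TOne (TScale (-1) TOne))"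
    by (simp add: pol_class_eq_iff pol_eq.add_minus pol_eq.sym)
  then have zero: "\<phi> (?C TZero) = (\<lambda>v. 0)"
    by (simp add: add scale scaleC_minus_one fun_eq_iff)
  show ?thesis
  proof (induction x)
    case (TStar x)
    show ?case using cadjoint_eqI[OF star[of x]] TStar.IH by simp
  qed (simp_all add: one add mult scale zero)
qed

lemma pol_generators_rep:
  fixes \<phi> :: "'n::{finite,linorder} star_term set \<Rightarrow> 'h::chilbert_space \<Rightarrow> 'h"
  assumes rep: "star_representation (Pol q) \<phi>"
  shows "pol_generators q (\<lambda>i. \<phi> (pol_class q (TA i))) (\<lambda>i. \<phi> (pol_class q (TStar (TA i))))
    (\<phi> (pol_class q TT))"
proof -
  let ?a = "\<lambda>i. \<phi> (pol_class q (TA i))" and ?b = "\<lambda>i. \<phi> (pol_class q (TStar (TA i)))"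
    and ?t = "\<phi> (pol_class q TT)"
  have bounded: "bounded_clinear (\<phi> (pol_class q x))"
    and star: "is_adjoint (\<phi> (pol_class q x)) (\<phi> (pol_class q (TStar x)))" for x
    using rep by (simp_all add: star_representation_def Pol_simps flip: Pol_simps(7))
  have cong: "eval_term ?a ?t x v = eval_term ?a ?t y v" if "pol_eq q x y" for x y v
    using that unfolding rep_eq_eval_term[OF rep, symmetric] by (simp flip: pol_class_eq_iff)
  have ba: "cadjoint (?a i) = ?b i" for i by (rule cadjoint_eqI) (rule star)
  have "?t = \<phi> (pol_class q (TStar TT))"
    by (metis pol_class_eq_iff pol_eq.rel_t_star)
  then have tt: "is_adjoint ?t ?t" using star[of TT] by simp
  show ?thesis
  proof
    fix i j :: 'n and v
    show "?a i (?t v) = of_real (q\<^sup>2) *\<^sub>C ?t (?a i v)"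
      using cong[OF pol_eq.rel_a_t[of q i], of v] by simp
    show "?a i (?a j v) = of_real (inverse q) *\<^sub>C ?a j (?a i v)" if "i < j"
      using cong[OF pol_eq.rel_a_a[OF that, of q], of v] by simp
    show "?a i (?b j v) = of_real (q ^ 3) *\<^sub>C ?b j (?a i v)" if "i < j"
      using cong[OF pol_eq.rel_a_astar[OF that, of q], of v] by (simp add: ba)
    show "?a i (?b i v) = of_real (q\<^sup>2) *\<^sub>C ?b i (?a i v) +
      of_real (q\<^sup>2 * (1 - q\<^sup>2)) *\<^sub>C (\<Sum>l | l < i. ?b l (?a l v)) + of_real (1 - q\<^sup>2) *\<^sub>C ?t (?t v)"
      using cong[OF pol_eq.rel_astar[of q i], of v] by (simp add: ba eval_term_sum)
    show "(\<Sum>i\<in>UNIV. of_real (q\<^sup>2) *\<^sub>C ?b i (?a i v)) = ?t v - ?t (?t v)"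
      using cong[OF pol_eq.rel_sphere[of q], of v] by (simp add: ba eval_term_sum scaleC_minus_one)
  qed (simp_all only: bounded star tt)
qed

context pol_generators
begin

lemma t_b: "t (b i v) = of_real (q\<^sup>2) *\<^sub>C b i (t v)"
proof -
  have "is_adjoint (a i \<circ> t) (t \<circ> b i)"
    by (rule is_adjoint_comp[OF a_adjoint t_adjoint])
  moreover have "is_adjoint (\<lambda>v. of_real (q\<^sup>2) *\<^sub>C (t \<circ> a i) v) (\<lambda>v. cnj (of_real (q\<^sup>2)) *\<^sub>C (b i \<circ> t) v)"
    by (rule is_adjoint_scaleC[OF is_adjoint_comp[OF t_adjoint a_adjoint]])
  moreover have "a i \<circ> t = (\<lambda>v. of_real (q\<^sup>2) *\<^sub>C (t \<circ> a i) v)" by (auto simp: a_t)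
  ultimately have "t \<circ> b i = (\<lambda>v. cnj (of_real (q\<^sup>2)) *\<^sub>C (b i \<circ> t) v)"
    by (metis is_adjoint_unique)
  then show ?thesis by (simp add: fun_eq_iff)
qed

text \<open>For \<open>j < i\<close> take adjoints in the relation with \<open>i\<close> and \<open>j\<close> exchanged; the coefficient is real.\<close>

lemma a_b_distinct:
  assumes "i \<noteq> j"
  shows "a i (b j v) = of_real (q ^ 3) *\<^sub>C b j (a i v)"
proof (cases "i < j")
  case False
  with assms have "j < i" by simp
  have "is_adjoint (a j \<circ> b i) (a i \<circ> b j)"
    by (rule is_adjoint_comp[OF a_adjoint is_adjoint_sym[OF a_adjoint]])
  moreover have "is_adjoint (\<lambda>v. of_real (q ^ 3) *\<^sub>C (b i \<circ> a j) v)
      (\<lambda>v. cnj (of_real (q ^ 3)) *\<^sub>C (b j \<circ> a i) v)"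
    by (rule is_adjoint_scaleC[OF is_adjoint_comp[OF is_adjoint_sym[OF a_adjoint] a_adjoint]])
  moreover have "a j \<circ> b i = (\<lambda>v. of_real (q ^ 3) *\<^sub>C (b i \<circ> a j) v)"
    using a_b[OF \<open>j < i\<close>] by auto
  ultimately have "a i \<circ> b j = (\<lambda>v. cnj (of_real (q ^ 3)) *\<^sub>C (b j \<circ> a i) v)"
    by (metis is_adjoint_unique)
  then show ?thesis by (simp add: fun_eq_iff)
qed (rule a_b)

lemma cadjoint_eval_simps:
  "cadjoint (\<lambda>v. eval_term a t x v + eval_term a t y v) =
    (\<lambda>v. cadjoint (eval_term a t x) v + cadjoint (eval_term a t y) v)"
  "cadjoint (\<lambda>v. eval_term a t x (eval_term a t y v)) =
    (\<lambda>v. cadjoint (eval_term a t y) (cadjoint (eval_term a t x) v))"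
  "cadjoint (\<lambda>v. c *\<^sub>C eval_term a t x v) = (\<lambda>v. cnj c *\<^sub>C cadjoint (eval_term a t x) v)"
  "cadjoint (cadjoint (eval_term a t x)) = eval_term a t x"
  using is_adjoint_add[OF adjoint_eval[of x] adjoint_eval[of y]]
    is_adjoint_comp[OF adjoint_eval[of x] adjoint_eval[of y]]
    is_adjoint_scaleC[OF adjoint_eval[of x], of c] is_adjoint_sym[OF adjoint_eval[of x]]
  by (simp_all only: comp_def cadjoint_eqI)

end

section \<open>Existence of a vacuum vector\<close>

context pol_generators
begin

text \<open>
  The quadratic form of \<open>t - t\<^sup>2\<close>, computed from the sphere relation. Both its positivity and the
  vanishing of all \<open>a\<^sub>i v\<close> where it vanishes are used below.
\<close>

lemma sphere_form: "q\<^sup>2 * (\<Sum>i\<in>UNIV. (norm (a i v))\<^sup>2) = t v \<bullet> v - (norm (t v))\<^sup>2"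
proof -
  have "t v \<bullet> v - (norm (t v))\<^sup>2 = v \<bullet> (t v - t (t v))"
    by (simp add: power2_norm_eq_inner inner_diff_right is_adjoint_inner[OF t_adjoint])
  also have "\<dots> = q\<^sup>2 * (\<Sum>i\<in>UNIV. v \<bullet> b i (a i v))"
    by (simp add: inner_sum_right sum_distrib_left sphere[symmetric] scaleR_scaleC[symmetric]
        del: of_real_power)
  finally show ?thesis
    by (simp add: power2_norm_eq_inner is_adjoint_inner[OF a_adjoint])
qed

lemma t_form_bounds: "(norm (t v))\<^sup>2 \<le> t v \<bullet> v" "0 \<le> t v \<bullet> v"
proof -
  have "0 \<le> q\<^sup>2 * (\<Sum>i\<in>UNIV. (norm (a i v))\<^sup>2)" by (simp add: sum_nonneg)
  then show "(norm (t v))\<^sup>2 \<le> t v \<bullet> v" by (simp add: sphere_form)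
  then show "0 \<le> t v \<bullet> v" by (rule order_trans[rotated]) simp
qed

lemma t_contraction: "norm (t v) \<le> norm v"
proof -
  have "norm (t v) * norm (t v) \<le> norm (t v) * norm v"
    using t_form_bounds(1)[of v] norm_cauchy_schwarz[of "t v" v] by (simp add: power2_eq_square)
  then show ?thesis by (cases "t v = 0") auto
qed

text \<open>
  The decay that drives the construction of the vacuum: since \<open>a\<^sub>i t = q\<^sup>2 t a\<^sub>i\<close>, passing from \<open>v\<close> to
  \<open>t v\<close> multiplies each \<open>\<parallel>a\<^sub>i v\<parallel>\<close> by at most \<open>q\<^sup>2 L\<close>, whereas \<open>\<parallel>v\<parallel>\<close> itself may be multiplied by \<open>L\<close>.
\<close>

lemma sphere_form_t:
  assumes "\<And>v. norm (t v) \<le> L * norm v"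
  shows "t (t v) \<bullet> t v - (norm (t (t v)))\<^sup>2 \<le> (q\<^sup>2 * L)\<^sup>2 * (t v \<bullet> v - (norm (t v))\<^sup>2)"
proof -
  have "(norm (a i (t v)))\<^sup>2 \<le> (q\<^sup>2 * L)\<^sup>2 * (norm (a i v))\<^sup>2" for i
  proof -
    have "norm (a i (t v)) = q\<^sup>2 * norm (t (a i v))"
      by (simp add: a_t scaleR_scaleC[symmetric] del: of_real_power)
    also have "\<dots> \<le> q\<^sup>2 * (L * norm (a i v))" by (intro mult_left_mono assms) simp
    finally have "(norm (a i (t v)))\<^sup>2 \<le> (q\<^sup>2 * (L * norm (a i v)))\<^sup>2"
      by (rule power_mono) simp
    then show ?thesis by (simp add: power_mult_distrib mult.assoc)
  qed
  then have "q\<^sup>2 * (\<Sum>i\<in>UNIV. (norm (a i (t v)))\<^sup>2) \<le>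
      q\<^sup>2 * (\<Sum>i\<in>UNIV. (q\<^sup>2 * L)\<^sup>2 * (norm (a i v))\<^sup>2)"
    by (intro mult_left_mono sum_mono) auto
  also have "\<dots> = (q\<^sup>2 * L)\<^sup>2 * (q\<^sup>2 * (\<Sum>i\<in>UNIV. (norm (a i v))\<^sup>2))"
    by (simp add: sum_distrib_left mult_ac)
  finally show ?thesis by (simp only: sphere_form)
qed

text \<open>
  In terms of the functional calculus of \<open>0 \<le> t \<le> 1\<close> this is \<open>t\<^sup>2 (1 - t)\<^sup>2 \<le> t\<^sup>2 (1 - t) \<le> t (1 - t)\<close>. The
  second inequality comes from the positivity of \<open>t\<close> on \<open>(1 - t) v\<close>, the first one from \<open>t\<^sup>2 \<le> t\<close> on
  \<open>t v\<close>.
\<close>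

lemma norm_step: "(norm (t v - t (t v)))\<^sup>2 \<le> t v \<bullet> v - (norm (t v))\<^sup>2"
proof -
  define x y where "x = t v" and "y = t x"
  have "0 \<le> t (v - x) \<bullet> (v - x)" by (rule t_form_bounds)
  also have "t (v - x) = x - y"
    by (simp add: bounded_clinearD(3)[OF t_bounded] x_def y_def)
  also have "(x - y) \<bullet> (v - x) = x \<bullet> v - 2 * (x \<bullet> x) + x \<bullet> y"
    using is_adjoint_inner[OF t_adjoint, of x v]
    by (simp add: y_def[symmetric] x_def[symmetric] inner_diff_left inner_diff_right inner_commute)
  finally have "x \<bullet> x - x \<bullet> y \<le> x \<bullet> v - x \<bullet> x" by simp
  moreover have "y \<bullet> y \<le> x \<bullet> y"
    using t_form_bounds(1)[of x] by (simp add: y_def power2_norm_eq_inner inner_commute)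
  ultimately have "(norm (x - y))\<^sup>2 \<le> x \<bullet> v - (norm x)\<^sup>2"
    by (simp add: power2_norm_eq_inner inner_diff_left inner_diff_right inner_commute)
  then show ?thesis by (simp only: x_def y_def)
qed

text \<open>For self-adjoint \<open>t\<close> the sequence \<open>\<parallel>t\<^bsup>n\<^esup> v\<parallel>\<close> is logarithmically convex by the Cauchy--Schwarz
  inequality, so its successive ratios increase from \<open>\<parallel>t v\<parallel>\<close>.\<close>

lemma norm_funpow_t_lower: "norm v = 1 \<Longrightarrow> norm (t v) ^ n \<le> norm ((t ^^ n) v)"
proof -
  assume v: "norm v = 1"
  have adj: "x \<bullet> t y = t x \<bullet> y" for x y using is_adjoint_inner[OF t_adjoint] by simp
  have convex: "norm (t x) * norm (t x) \<le> norm x * norm (t (t x))" for x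
    using norm_cauchy_schwarz[of x "t (t x)"]
    by (simp add: adj flip: power2_eq_square power2_norm_eq_inner)
  have ratio: "norm (t v) * norm ((t ^^ n) v) \<le> norm (t ((t ^^ n) v))" for n
  proof (induction n)
    case (Suc n)
    let ?x = "(t ^^ n) v"
    show ?case
    proof (cases "?x = 0")
      case False
      have "(norm (t v) * norm (t ?x)) * norm ?x \<le> norm (t ?x) * norm (t ?x)"
        using mult_right_mono[OF Suc.IH norm_ge_zero[of "t ?x"]] by (simp add: mult_ac)
      also note convex[of ?x]
      finally show ?thesis using False by (simp add: mult_ac)
    qed (simp add: bounded_clinearD(4)[OF t_bounded])
  qed (simp add: v)
  show ?thesis
  proof (induction n)
    case (Suc n)
    have "norm (t v) ^ Suc n \<le> norm (t v) * norm ((t ^^ n) v)"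
      using mult_left_mono[OF Suc.IH norm_ge_zero[of "t v"]] by simp
    also note ratio[of n]
    finally show ?case by simp
  qed (simp add: v)
qed

text \<open>
  The steps of the sequence \<open>t\<^bsup>n+1\<^esup> v\<close> are bounded by a constant times \<open>r\<^bsup>n\<^esup>\<close> with \<open>r = q\<^sup>2 \<parallel>t\<parallel> < 1\<close>, so it
  has a limit, which \<open>t\<close> fixes. As \<open>t \<noteq> 0\<close> and \<open>q < 1\<close>, \<open>r < \<parallel>t\<parallel>\<close>, so there is a unit vector \<open>v\<close> with \<open>\<parallel>t v\<parallel> > r\<close>. If the
  limit were 0, then \<open>\<parallel>t\<^bsup>n+1\<^esup> v\<parallel>\<close> would be at most a constant times \<open>r\<^bsup>n\<^esup>\<close>, against the lower bound
  \<open>\<parallel>t v\<parallel>\<^bsup>n+1\<^esup>\<close>.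
\<close>

lemma vacuum_exists:
  assumes q: "0 < q" "q < 1" and nonzero: "t \<noteq> (\<lambda>v. 0)"
  obtains p where "p \<noteq> 0" "t p = p"
proof -
  note t_lin = bounded_clinearD(1)[OF t_bounded]
  define L where "L = onorm t"
  define r where "r = q\<^sup>2 * L"
  have L: "norm (t v) \<le> L * norm v" for v
    unfolding L_def by (rule onorm[OF t_lin])
  have "0 < L"
    using onorm_pos_lt[OF t_lin] nonzero by (auto simp: L_def)
  have "L \<le> 1" unfolding L_def by (rule onorm_bound) (simp_all add: t_contraction)
  have "q\<^sup>2 < 1" using q by (simp add: power_less_one_iff)
  then have "r < L"
    using \<open>0 < L\<close> mult_strict_right_mono[of "q\<^sup>2" 1 L] by (simp add: r_def)
  moreover have "0 < r" using q \<open>0 < L\<close> by (simp add: r_def)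
  ultimately have r: "0 < r" "r < L" "r < 1" using \<open>L \<le> 1\<close> by linarith+
  obtain v where v: "norm v = 1" "r < norm (t v)"
  proof -
    have "\<exists>x. r * norm x < norm (t x)"
    proof (rule ccontr)
      assume "\<nexists>x. r * norm x < norm (t x)"
      then have "L \<le> r" unfolding L_def using r by (intro onorm_bound) (auto simp: not_less)
      then show False using r by simp
    qed
    then obtain x where x: "r * norm x < norm (t x)" by blast
    then have "x \<noteq> 0" by (auto simp: bounded_clinearD(4)[OF t_bounded])
    then have "norm (t (x /\<^sub>R norm x)) > r"
      using x by (simp add: bounded_clinearD(6)[OF t_bounded] field_simps)
    moreover have "norm (x /\<^sub>R norm x) = 1" using \<open>x \<noteq> 0\<close> by simp
    ultimately show ?thesis using that by blast
  qed
  define Q where "Q x = t x \<bullet> x - (norm (t x))\<^sup>2" for x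
  have Q_nonneg: "0 \<le> Q x" for x using t_form_bounds(1) by (simp add: Q_def)
  have Q_funpow: "Q ((t ^^ n) v) \<le> (r ^ n)\<^sup>2 * Q v" for n
  proof (induction n)
    case (Suc n)
    have "Q ((t ^^ Suc n) v) \<le> r\<^sup>2 * Q ((t ^^ n) v)"
      using sphere_form_t[OF L] by (simp add: Q_def r_def)
    also have "\<dots> \<le> r\<^sup>2 * ((r ^ n)\<^sup>2 * Q v)" by (intro mult_left_mono Suc.IH) simp
    finally show ?case by (simp add: power_mult_distrib mult_ac)
  qed simp
  define X where "X n = (t ^^ Suc n) v" for n
  have "norm (X n - X (Suc n)) \<le> sqrt (Q v) * r ^ n" for n
  proof (rule power2_le_imp_le)
    have "(norm (X n - X (Suc n)))\<^sup>2 \<le> (r ^ n)\<^sup>2 * Q v"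
      using norm_step[of "(t ^^ n) v"] Q_funpow[of n] by (simp add: X_def Q_def)
    then show "(norm (X n - X (Suc n)))\<^sup>2 \<le> (sqrt (Q v) * r ^ n)\<^sup>2"
      using Q_nonneg by (simp add: power_mult_distrib mult.commute)
  qed (use Q_nonneg r in simp)
  then obtain p where p: "X \<longlonglongrightarrow> p" "\<And>n. norm (X n - p) \<le> sqrt (Q v) * r ^ n / (1 - r)"
    using geometric_steps_converge[of X "sqrt (Q v)" r] r by auto
  have "(\<lambda>n. t (X n)) \<longlonglongrightarrow> t p" by (rule bounded_linear.tendsto[OF t_lin p(1)])
  moreover have "(\<lambda>n. t (X n)) \<longlonglongrightarrow> p" using LIMSEQ_Suc[OF p(1)] by (simp add: X_def)
  ultimately have "t p = p" by (rule LIMSEQ_unique)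
  moreover have "p \<noteq> 0"
  proof
    assume "p = 0"
    define s where "s = norm (t v) / r"
    have s: "1 < s" using v r by (simp add: s_def)
    have "s ^ n \<le> sqrt (Q v) / (1 - r) / norm (t v)" for n
    proof -
      have "norm (t v) ^ Suc n \<le> sqrt (Q v) * r ^ n / (1 - r)"
        using norm_funpow_t_lower[OF v(1), of "Suc n"] p(2)[of n] \<open>p = 0\<close> by (simp add: X_def)
      moreover have "0 < norm (t v)" using v r by linarith
      ultimately show ?thesis using r by (simp add: s_def field_simps)
    qed
    moreover obtain n where "sqrt (Q v) / (1 - r) / norm (t v) < s ^ n"
      using real_arch_pow[OF s] by blast
    ultimately show False using not_less by blast
  qed
  ultimately show ?thesis using that by blast
qed

text \<open>On a vector with \<open>t\<^sup>2 v = t v\<close> the quadratic form of the sphere relation vanishes. This covers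
  both \<open>t = 0\<close> and the fixed vectors of \<open>t\<close>.\<close>

lemma a_eq_0:
  assumes "q \<noteq> 0" "t (t v) = t v"
  shows "a i v = 0"
proof -
  have "t v \<bullet> v = (norm (t v))\<^sup>2"
    using is_adjoint_inner[OF t_adjoint, of "t v" v] assms(2) by (simp add: power2_norm_eq_inner)
  then have "(\<Sum>i\<in>UNIV. (norm (a i v))\<^sup>2) = 0"
    using sphere_form[of v] assms(1) by simp
  then show ?thesis by (simp add: sum_nonneg_eq_0_iff)
qed

end

section \<open>The vacuum determines the representation\<close>

text \<open>The eigenvalue \<open>\<mu>\<close> is 0 for the comparison with \<open>\<epsilon>\<close> and 1 for the one with \<open>\<sigma>\<^sub>n\<close>.\<close>

locale vacuum_pair =
  L: pol_generators q a b t + R: pol_generators q a' b' t'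
  for q :: real
    and a :: "'n::{finite,linorder} \<Rightarrow> 'h::chilbert_space \<Rightarrow> 'h" and b t
    and a' :: "'n \<Rightarrow> 'k::chilbert_space \<Rightarrow> 'k" and b' t' +
  fixes v :: 'h and w :: 'k and \<mu> :: complex
  assumes a_v: "\<And>i. a i v = 0" and a_w: "\<And>i. a' i w = 0"
    and t_v: "t v = \<mu> *\<^sub>C v" and t_w: "t' w = \<mu> *\<^sub>C w"
    and cinner_vw: "cinner v v = cinner w w"
begin

text \<open>
  This is the graph of the intertwiner on the span of the vectors \<open>b\<^sub>i \<dots> b\<^sub>j v\<close>. It is set up as a
  relation because these vectors may be linearly dependent; that \<open>y\<close> is determined by \<open>x\<close>
  only follows from \<open>corr_cinner\<close>.
\<close>

inductive corr :: "'h \<Rightarrow> 'k \<Rightarrow> bool" where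
  vacuum: "corr v w"
| add: "corr x y \<Longrightarrow> corr x' y' \<Longrightarrow> corr (x + x') (y + y')"
| scale: "corr x y \<Longrightarrow> corr (c *\<^sub>C x) (c *\<^sub>C y)"
| creation: "corr x y \<Longrightarrow> corr (b i x) (b' i y)"

lemma corr_zero: "corr 0 0"
  using scale[OF vacuum, of 0] by (simp add: scaleC_zero_left)

lemma corr_sum: "(\<And>i. i \<in> I \<Longrightarrow> corr (x i) (y i)) \<Longrightarrow> corr (\<Sum>i\<in>I. x i) (\<Sum>i\<in>I. y i)"
  by (induction I rule: infinite_finite_induct) (auto intro: corr_zero add)

lemma corr_t: "corr x y \<Longrightarrow> corr (t x) (t' y)"
proof (induction rule: corr.induct)
  case vacuum
  show ?case unfolding t_v t_w by (intro scale corr.vacuum)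
qed (auto simp: L.t_b R.t_b bounded_clinearD[OF L.t_bounded] bounded_clinearD[OF R.t_bounded]
    intro: corr.intros)

text \<open>
  Normal ordering: \<open>a\<^sub>i b\<^sub>j\<close> is a combination of operators \<open>b\<^sub>l a\<^sub>k\<close> and \<open>t\<^sup>2\<close> with the same coefficients on
  both sides. The induction treats all \<open>i\<close> at once because \<open>a\<^sub>i b\<^sub>i\<close> involves every \<open>a\<^sub>l\<close> with
  \<open>l \<le> i\<close>.
\<close>

lemma corr_a: "corr x y \<Longrightarrow> corr (a i x) (a' i y)"
proof (induction arbitrary: i rule: corr.induct)
  case vacuum
  show ?case by (simp add: a_v a_w corr_zero)
next
  case (creation x y j)
  show ?case
  proof (cases "i = j")
    case True
    show ?thesis
      unfolding True L.a_b_same R.a_b_same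
      by (intro add scale corr_sum corr.creation corr_t creation)
  next
    case False
    then show ?thesis
      unfolding L.a_b_distinct[OF False] R.a_b_distinct[OF False]
      by (intro scale corr.creation creation)
  qed
qed (auto simp: bounded_clinearD[OF L.a_bounded] bounded_clinearD[OF R.a_bounded]
    intro: corr.intros)

text \<open>Each \<open>b\<^sub>i\<close> on the left moves to the right as \<open>a\<^sub>i\<close>, which preserves the correspondence. Once the
  left argument is the vacuum, each \<open>b\<^sub>i\<close> on the right moves back and annihilates it.\<close>

lemma corr_cinner: "corr x y \<Longrightarrow> corr x' y' \<Longrightarrow> cinner x x' = cinner y y'"
proof (induction arbitrary: x' y' rule: corr.induct)
  case vacuum
  then show ?case
  proof (induction rule: corr.induct)
    case (creation x y i)
    have "cinner v (b i x) = 0" "cinner w (b' i y) = 0"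
      using L.a_adjoint[of i] R.a_adjoint[of i]
      by (simp_all add: is_adjoint_def a_v a_w flip: L.a_adjoint R.a_adjoint)
        (metis a_v a_w cinner_zero_left)+
    then show ?case by simp
  qed (simp_all add: cinner_vw cinner_add_right cinner_scaleC_right)
next
  case (creation x y i)
  have "cinner (b i x) x' = cinner x (a i x')" "cinner (b' i y) y' = cinner y (a' i y')"
    using is_adjoint_sym[OF L.a_adjoint[of i]] is_adjoint_sym[OF R.a_adjoint[of i]]
    by (simp_all add: is_adjoint_def)
  then show ?case using creation.IH[OF corr_a[OF creation.prems]] by simp
qed (simp_all add: cinner_add_left cinner_scaleC_left)

text \<open>The statement about the adjoint goes along in the induction for the terms with a star.\<close>

lemma corr_eval_cadjoint:
  "(\<forall>x y. corr x y \<longrightarrow> corr (eval_term a t s x) (eval_term a' t' s y)) \<and>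
   (\<forall>x y. corr x y \<longrightarrow> corr (cadjoint (eval_term a t s) x) (cadjoint (eval_term a' t' s) y))"
  by (induction s)
    (simp_all add: L.cadjoint_a R.cadjoint_a L.cadjoint_t R.cadjoint_t L.cadjoint_eval_simps
      R.cadjoint_eval_simps cadjoint_zero cadjoint_id corr_zero corr_a corr_t corr.intros)

lemma unitary_intertwiner:
  assumes dom: "closure {x. \<exists>y. corr x y} = UNIV"
    and ran: "closure {y. \<exists>x. corr x y} = UNIV"
  shows "\<exists>U. unitary_map U \<and> (\<forall>s. U \<circ> eval_term a t s = eval_term a' t' s \<circ> U)"
proof -
  have "norm x = norm y" if "corr x y" for x y
    using corr_cinner[OF that that] by (simp add: cinner_self flip: of_real_power)
  from unitary_extension[of corr, OF add scale this dom ran]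
  obtain U where "unitary_map U" "\<And>F G. bounded_clinear F \<Longrightarrow> bounded_clinear G \<Longrightarrow>
      (\<And>x y. corr x y \<Longrightarrow> corr (F x) (G y)) \<Longrightarrow> U \<circ> F = G \<circ> U"
    by blast
  then show ?thesis
    using L.bounded_eval R.bounded_eval corr_eval_cadjoint by blast
qed

lemma corr_subspaces:
  "module.subspace scaleC {x. \<exists>y. corr x y}" "module.subspace scaleC {y. \<exists>x. corr x y}"
  by (auto simp: subspace_scaleC_iff intro: corr_zero add scale)

end

text \<open>
  The closure of the set of matched vectors is an invariant subspace of the irreducible
  representation \<open>\<phi>\<close> and contains \<open>v\<close>, so it is everything. Cyclicity of \<open>w\<close> is required for the \<open>b\<^sub>i\<close>
  alone, in the form in which it is checked for \<open>\<epsilon>\<close> and \<open>\<sigma>\<^sub>n\<close>.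
\<close>

lemma unitarily_equivalent_if_vacuum:
  fixes q :: real and \<phi> :: "'n::{finite,linorder} star_term set \<Rightarrow> 'h::chilbert_space \<Rightarrow> 'h"
    and \<psi> :: "'n star_term set \<Rightarrow> 'k::chilbert_space \<Rightarrow> 'k"
  defines "A \<equiv> Pol q :: 'n star_term set star_algebra"
  assumes irr: "irreducible_representation A \<phi>"
    and rep: "star_representation A \<psi>"
    and v: "norm v = 1" "\<And>i. \<phi> (pol_class q (TA i)) v = 0" "\<phi> (pol_class q TT) v = \<mu> *\<^sub>C v"
    and w: "norm w = 1" "\<And>i. \<psi> (pol_class q (TA i)) w = 0" "\<psi> (pol_class q TT) w = \<mu> *\<^sub>C w"
    and cyclic: "\<And>S. module.subspace scaleC S \<Longrightarrow> w \<in> S \<Longrightarrow>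
      (\<And>i y. y \<in> S \<Longrightarrow> \<psi> (pol_class q (TStar (TA i))) y \<in> S) \<Longrightarrow> closure S = UNIV"
  shows "unitarily_equivalent A \<phi> \<psi>"
proof -
  have rep\<phi>: "star_representation A \<phi>"
    using irr by (simp add: irreducible_representation_def)
  have irreducible: "S = {0} \<or> S = UNIV" if "closed S" "module.subspace scaleC S"
    "\<And>X. X \<in> alg_carrier A \<Longrightarrow> \<phi> X ` S \<subseteq> S" for S
    using irr that unfolding irreducible_representation_def by (elim conjE allE[of _ S]) simp
  interpret vacuum_pair q
    "\<lambda>i. \<phi> (pol_class q (TA i))" "\<lambda>i. \<phi> (pol_class q (TStar (TA i)))" "\<phi> (pol_class q TT)"
    "\<lambda>i. \<psi> (pol_class q (TA i))" "\<lambda>i. \<psi> (pol_class q (TStar (TA i)))" "\<psi> (pol_class q TT)"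
    v w \<mu>
    by (intro vacuum_pair.intro pol_generators_rep vacuum_pair_axioms.intro)
      (use rep\<phi> rep v w in \<open>simp_all add: A_def cinner_self\<close>)
  note eval = rep_eq_eval_term[OF rep\<phi>[unfolded A_def]] rep_eq_eval_term[OF rep[unfolded A_def]]
  let ?D = "{x. \<exists>y. corr x y}"
  have "module.subspace scaleC (closure ?D)"
    by (intro subspace_scaleC_closure corr_subspaces)
  moreover have "\<phi> X ` closure ?D \<subseteq> closure ?D" if X: "X \<in> alg_carrier A" for X
  proof (rule bounded_clinear_image_closure)
    show "bounded_clinear (\<phi> X)" using rep\<phi> X by (simp add: star_representation_def)
    obtain s where "X = pol_class q s" using X by (auto simp: A_def Pol_simps)
    then have "corr x y \<Longrightarrow> corr (\<phi> X x) (\<psi> (pol_class q s) y)" for x y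
      using corr_eval_cadjoint[of s] by (simp only: eval[of s])
    then show "\<phi> X ` ?D \<subseteq> ?D" by blast
  qed
  ultimately have "closure ?D = {0} \<or> closure ?D = UNIV"
    by (intro irreducible closed_closure)
  moreover have "v \<in> closure ?D" "v \<noteq> 0"
    using closure_subset[of ?D] vacuum v(1) by auto
  ultimately have dom: "closure ?D = UNIV" by auto
  have ran: "closure {y. \<exists>x. corr x y} = UNIV"
    by (rule cyclic) (auto intro: corr_subspaces vacuum creation)
  from unitary_intertwiner[OF dom ran] obtain U where U: "unitary_map U"
    "\<And>s. U \<circ> \<phi> (pol_class q s) = \<psi> (pol_class q s) \<circ> U"
    unfolding eval[symmetric] by blast
  then show ?thesis
    unfolding unitarily_equivalent_def A_def Pol_simps(1) by blast
qed

section \<open>The vacuum vectors of the two model representations\<close>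

lemma eps_cyclic:
  fixes S :: "complex set"
  assumes "module.subspace scaleC S" "1 \<in> S"
  shows "closure S = UNIV"
proof -
  have "c \<in> S" for c
    using assms by (metis mult.right_neutral scaleC_complex_def subspace_scaleC_iff)
  then have "S = UNIV" by auto
  then show ?thesis by simp
qed

lemma sigma_vacuum:
  assumes q: "0 < q" "q < 1"
  shows "sigma_a q i (ket (\<lambda>_. 0)) = 0"
    and "sigma_t q (ket (\<lambda>_. 0)) = (ket (\<lambda>_. 0) :: ('n::{finite,linorder} \<Rightarrow> nat) ell2)"
proof -
  show "sigma_a q i (ket (\<lambda>_. 0)) = 0"
    by (rule ell2_eqI) (auto simp: Rep_sigma_a[OF q] Rep_ket Rep_zero_ell2 dest: fun_cong[of _ _ i])
  show "sigma_t q (ket (\<lambda>_. 0)) = (ket (\<lambda>_. 0) :: ('n \<Rightarrow> nat) ell2)"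
    by (rule ell2_eqI) (auto simp: Rep_sigma_t[OF q] Rep_ket total_coeff_def)
qed

lemma sigma_coeff_pos:
  assumes q: "0 < q" "q < 1"
  shows "0 < sigma_coeff q i m"
proof -
  have "q ^ (2 * Suc (m i)) < 1" by (rule power_less_one_iff[THEN iffD2]) (use q in auto)
  then have "0 < alpha_coeff q (m i)" using q by (simp add: alpha_coeff_def)
  moreover have "0 < (\<Prod>k\<in>UNIV. (q ^ (2 * m k)) powr M_exp i k)"
    by (rule prod_pos) (use q in simp)
  ultimately show ?thesis by (simp add: sigma_coeff_def)
qed

lemma sigma_b_ket:
  assumes q: "0 < q" "q < 1"
  shows "sigma_b q i (ket m) = of_real (sigma_coeff q i m) *\<^sub>C ket (raise i m)"
proof (rule ell2_eqI)
  fix k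
  show "Rep_ell2 (sigma_b q i (ket m)) k = Rep_ell2 (of_real (sigma_coeff q i m) *\<^sub>C ket (raise i m)) k"
  proof (cases "k i = 0")
    case True
    then have "k \<noteq> raise i m" by auto
    then show ?thesis using True by (simp add: Rep_sigma_b[OF q] Rep_scaleC_ell2 Rep_ket)
  next
    case False
    then have "k \<in> range (raise i)" by (simp only: range_raise not_False_eq_True)
    then obtain k' where k: "k = raise i k'" by (rule rangeE)
    have "raise i k' = raise i m \<longleftrightarrow> k' = m" by (rule inj_eq) (rule inj_raise)
    then show ?thesis unfolding k Rep_sigma_b(1)[OF q] Rep_scaleC_ell2 Rep_ket by simp
  qed
qed

text \<open>Every basis vector arises from the vacuum by creation operators, whose weights on the basis
  are nonzero.\<close>

lemma sigma_cyclic: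
  fixes S :: "('n::{finite,linorder} \<Rightarrow> nat) ell2 set"
  assumes q: "0 < q" "q < 1"
    and S: "module.subspace scaleC S" "ket (\<lambda>_. 0) \<in> S"
    and creation: "\<And>i y. y \<in> S \<Longrightarrow> sigma_b q i y \<in> S"
  shows "closure S = UNIV"
proof (rule ket_total[OF S(1)])
  fix m :: "'n \<Rightarrow> nat"
  show "ket m \<in> S"
  proof (induction "\<Sum>i\<in>UNIV. m i" arbitrary: m)
    case 0
    then have "m = (\<lambda>_. 0)" by auto
    then show ?case using S(2) by simp
  next
    case (Suc N)
    then obtain i where "m i \<noteq> 0" by (metis sum.neutral nat.distinct(1))
    then have "m \<in> range (raise i)" by (simp only: range_raise not_False_eq_True)
    then obtain k where m: "m = raise i k" by (rule rangeE)
    have "(\<Sum>j\<in>UNIV. raise i k j) = Suc (\<Sum>j\<in>UNIV. k j)"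
      by (simp add: sum.remove[of UNIV i])
    then have "ket k \<in> S" using Suc m by simp
    then have "of_real (inverse (sigma_coeff q i k)) *\<^sub>C sigma_b q i (ket k) \<in> S"
      using S(1) creation by (simp add: subspace_scaleC_iff)
    also have "of_real (inverse (sigma_coeff q i k)) *\<^sub>C sigma_b q i (ket k) = ket m"
      using sigma_coeff_pos[OF q, of i k]
      by (simp add: m sigma_b_ket[OF q] scaleC_scaleC scaleC_one flip: of_real_mult)
    finally show ?case .
  qed
qed

section \<open>The classification\<close>

theorem proposition5:
  fixes q :: real
    and \<phi> :: "'n::{finite,linorder} star_term set \<Rightarrow> 'h::chilbert_space \<Rightarrow> 'h"
  assumes "0 < q" and "q < 1"
    and "irreducible_representation (Pol q) \<phi>"
  shows "unitarily_equivalent (Pol q) \<phi> eps_rep \<or>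
    unitarily_equivalent (Pol q) \<phi> (sigma_rep q)"
proof -
  note q = assms(1,2) and irr = assms(3)
  let ?a = "\<lambda>i. \<phi> (pol_class q (TA i))" and ?t = "\<phi> (pol_class q TT)"
  have rep: "star_representation (Pol q) \<phi>" and "\<exists>v::'h. v \<noteq> 0"
    using irr by (simp_all add: irreducible_representation_def)
  interpret pol_generators q ?a "\<lambda>i. \<phi> (pol_class q (TStar (TA i)))" ?t
    using rep by (rule pol_generators_rep)
  have normalize: "norm (v /\<^sub>R norm v) = 1" "?t (v /\<^sub>R norm v) = ?t v /\<^sub>R norm v"
    if "v \<noteq> 0" for v
    using that bounded_clinearD(6)[OF t_bounded] by simp_all
  show ?thesis
  proof (cases "?t = (\<lambda>v. 0)")
    case True
    obtain v :: 'h where "v \<noteq> 0" using \<open>\<exists>v::'h. v \<noteq> 0\<close> by blast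
    note v = normalize[OF this]
    have "unitarily_equivalent (Pol q) \<phi> eps_rep"
      by (rule unitarily_equivalent_if_vacuum[OF irr star_representation_eps v(1),
            where w = 1 and \<mu> = 0])
        (use q True in \<open>simp_all add: a_eq_0 eps_rep_generators scaleC_zero_left eps_cyclic\<close>)
    then show ?thesis ..
  next
    case False
    obtain p where "p \<noteq> 0" "?t p = p" using vacuum_exists[OF q False] .
    with normalize[of p] have p: "norm (p /\<^sub>R norm p) = 1" "?t (p /\<^sub>R norm p) = p /\<^sub>R norm p"
      by simp_all
    have b: "sigma_rep q (pol_class q (TStar (TA i))) = sigma_b q i" for i :: 'n
      using pol_generators.cadjoint_a[OF sigma_generators[OF q]]
      by (simp add: sigma_rep_def pol_generators.gen_rep_class[OF sigma_generators[OF q]])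
    have "unitarily_equivalent (Pol q) \<phi> (sigma_rep q)"
      by (intro unitarily_equivalent_if_vacuum[OF irr star_representation_sigma[OF q] p(1),
            where w = "ket (\<lambda>_. 0)" and \<mu> = 1])
        (use q p in \<open>simp_all add: a_eq_0 sigma_rep_generators sigma_vacuum norm_ket scaleC_one b sigma_cyclic\<close>)
    then show ?thesis ..
  qed
qed

end
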